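(* Let $\mathcal{A}$ be an abelian category, $n\geq 1$, $I=\{1,\dots,n\}$, let $F=(F_i)_{i\in I}$ be a family of additive right exact endofunctors of $\mathcal{A}$, each admitting a right adjoint, with an associative family $\Phi=(\Phi_{i,j}:F_iF_j\to F_{i+j})$ of natural transformations. If $\mathcal{A}$ has enough projective objects, then the following assertions are equivalent for an object $(X,f)$ of the right $n$-trivial extension $\mathcal{A}\ltimes_n F$: (1) $(X,f)$ is projective. (2) There exists a projective object $P$ in $\mathcal{A}$ such that $(X,f)$ is a direct summand of $T(P)$. (3) $C(X,f)$ is projective and $T(C(X,f))\cong(X,f)$.
   Context: $\Phi$ consists of natural transformations $\Phi_{i,j}:F_iF_j\to F_{i+j}$ for $i,j\in I$ with $i+j\in I$; it is associative if $(\Phi_{i,j+k})_X\circ F_i((\Phi_{j,k})_X)=(\Phi_{i+j,k})_X\circ(\Phi_{i,j})_{F_kX}$ for all objects $X$ and all $i,j,k\in I$ with $i+j+k\in I$. Objects of $\mathcal{A}\ltimes_n F$ are pairs $(X,f)$ with $X$ in $\mathcal{A}$ and $f=(f_i:F_iX\to X)_{i\in I}$ such that for all $i,j\in I$: $f_i\circ F_i(f_j)=f_{i+j}\circ(\Phi_{i,j})_X$ if $i+j\leq n$, and $f_i\circ F_i(f_j)=0$ if $i+j>n$. A morphism $(X,\alpha)\to(Y,\beta)$ is a morphism $\gamma:X\to Y$ in $\mathcal{A}$ with $\gamma\circ\alpha_i=\beta_i\circ F_i(\gamma)$ for all $i$. Functor $T:\mathcal{A}\to\mathcal{A}\ltimes_n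 F$: $T(X)=(X\oplus\bigoplus_{j\in I}F_jX,\kappa)$, where $\kappa_i:F_iX\oplus\bigoplus_{j\in I}F_iF_jX\to X\oplus\bigoplus_{j\in I}F_jX$ maps $F_iX$ identically to the summand $F_iX$, maps $F_iF_jX$ to $F_{i+j}X$ by $(\Phi_{i,j})_X$ if $i+j\leq n$, and has all other components zero; $T(\alpha)=\mathrm{diag}(\alpha,F_1\alpha,\dots,F_n\alpha)$. Functor $C:\mathcal{A}\ltimes_n F\to\mathcal{A}$: $C(X,f)=\operatorname{Coker}\big((f_i)_i:\bigoplus_{i\in I}F_iX\to X\big)$, with the induced maps on morphisms. *)

theory Defs
  imports "HOL-Algebra.FiniteProduct"
begin

section \<open>Categories\<close>

text \<open>
  One record carries the data of a category together with an addition and zero arrows;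
  the last two fields are only constrained from the locale \<open>preadditive_category\<close> on.
  \<open>g \<cdot>\<^bsub>C\<^esub> f\<close> is "\<open>g\<close> after \<open>f\<close>"; it is only meaningful if \<open>Dom C g = Cod C f\<close>.
\<close>

record ('o, 'm) cat =
  Ob :: "'o set"
  Ar :: "'m set"
  Dom :: "'m \<Rightarrow> 'o"
  Cod :: "'m \<Rightarrow> 'o"
  Ident :: "'o \<Rightarrow> 'm"
  Comp :: "'m \<Rightarrow> 'm \<Rightarrow> 'm" (infixr "\<cdot>\<index>" 70)
  Add :: "'m \<Rightarrow> 'm \<Rightarrow> 'm"
  Zero :: "'o \<Rightarrow> 'o \<Rightarrow> 'm"

definition Hom :: "('o, 'm) cat \<Rightarrow> 'o \<Rightarrow> 'o \<Rightarrow> 'm set" where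
  "Hom C X Y = {f \<in> Ar C. Dom C f = X \<and> Cod C f = Y}"

locale category =
  fixes C :: "('o, 'm) cat" (structure)
  assumes Dom_in_Ob: "f \<in> Ar C \<Longrightarrow> Dom C f \<in> Ob C"
    and Cod_in_Ob: "f \<in> Ar C \<Longrightarrow> Cod C f \<in> Ob C"
    and Ident_in_Hom: "X \<in> Ob C \<Longrightarrow> Ident C X \<in> Hom C X X"
    and Comp_in_Hom: "\<lbrakk>f \<in> Hom C X Y; g \<in> Hom C Y Z\<rbrakk> \<Longrightarrow> g \<cdot> f \<in> Hom C X Z"
    and Comp_assoc:
      "\<lbrakk>f \<in> Hom C W X; g \<in> Hom C X Y; h \<in> Hom C Y Z\<rbrakk> \<Longrightarrow> (h \<cdot> g) \<cdot> f = h \<cdot> (g \<cdot> f)"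
    and Comp_Ident_right: "f \<in> Hom C X Y \<Longrightarrow> f \<cdot> Ident C X = f"
    and Comp_Ident_left: "f \<in> Hom C X Y \<Longrightarrow> Ident C Y \<cdot> f = f"

definition is_mono :: "('o, 'm) cat \<Rightarrow> 'm \<Rightarrow> bool" where
  "is_mono C f \<longleftrightarrow> f \<in> Ar C \<and>
    (\<forall>W. \<forall>g \<in> Hom C W (Dom C f). \<forall>h \<in> Hom C W (Dom C f). f \<cdot>\<^bsub>C\<^esub> g = f \<cdot>\<^bsub>C\<^esub> h \<longrightarrow> g = h)"

definition is_epi :: "('o, 'm) cat \<Rightarrow> 'm \<Rightarrow> bool" where
  "is_epi C f \<longleftrightarrow> f \<in> Ar C \<and>
    (\<forall>W. \<forall>g \<in> Hom C (Cod C f) W. \<forall>h \<in> Hom C (Cod C f) W. g \<cdot>\<^bsub>C\<^esub> f = h \<cdot>\<^bsub>C\<^esub> f \<longrightarrow> g = h)"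

definition isomorphic :: "('o, 'm) cat \<Rightarrow> 'o \<Rightarrow> 'o \<Rightarrow> bool" where
  "isomorphic C X Y \<longleftrightarrow> X \<in> Ob C \<and> Y \<in> Ob C \<and>
    (\<exists>f \<in> Hom C X Y. \<exists>g \<in> Hom C Y X. g \<cdot>\<^bsub>C\<^esub> f = Ident C X \<and> f \<cdot>\<^bsub>C\<^esub> g = Ident C Y)"

definition projective :: "('o, 'm) cat \<Rightarrow> 'o \<Rightarrow> bool" where
  "projective C P \<longleftrightarrow> P \<in> Ob C \<and>
    (\<forall>e. is_epi C e \<longrightarrow> (\<forall>g \<in> Hom C P (Cod C e). \<exists>h \<in> Hom C P (Dom C e). e \<cdot>\<^bsub>C\<^esub> h = g))"

definition enough_projectives :: "('o, 'm) cat \<Rightarrow> bool" where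
  "enough_projectives C \<longleftrightarrow>
    (\<forall>X \<in> Ob C. \<exists>P e. projective C P \<and> e \<in> Hom C P X \<and> is_epi C e)"


section \<open>Abelian categories\<close>

definition hom_group :: "('o, 'm) cat \<Rightarrow> 'o \<Rightarrow> 'o \<Rightarrow> 'm monoid" where
  "hom_group C X Y = \<lparr>carrier = Hom C X Y, mult = Add C, one = Zero C X Y\<rparr>"

definition hom_sum :: "('o, 'm) cat \<Rightarrow> 'o \<Rightarrow> 'o \<Rightarrow> ('i \<Rightarrow> 'm) \<Rightarrow> 'i set \<Rightarrow> 'm" where
  "hom_sum C X Y f J = finprod (hom_group C X Y) f J"

locale preadditive_category = category +
  assumes hom_comm_group: "\<lbrakk>X \<in> Ob C; Y \<in> Ob C\<rbrakk> \<Longrightarrow> comm_group (hom_group C X Y)"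
    and Comp_Add_right:
      "\<lbrakk>f \<in> Hom C X Y; f' \<in> Hom C X Y; g \<in> Hom C Y Z\<rbrakk> \<Longrightarrow>
        g \<cdot> Add C f f' = Add C (g \<cdot> f) (g \<cdot> f')"
    and Comp_Add_left:
      "\<lbrakk>f \<in> Hom C X Y; g \<in> Hom C Y Z; g' \<in> Hom C Y Z\<rbrakk> \<Longrightarrow>
        Add C g g' \<cdot> f = Add C (g \<cdot> f) (g' \<cdot> f)"

text \<open>
  \<open>B\<close> with injections \<open>\<iota>\<close> and projections \<open>\<pi>\<close> is the direct sum of the family \<open>X\<close> over the
  finite set \<open>J\<close>. For empty \<open>J\<close> this says that \<open>B\<close> is a zero object.
\<close>

definition is_biproduct ::
  "('o, 'm) cat \<Rightarrow> 'i set \<Rightarrow> ('i \<Rightarrow> 'o) \<Rightarrow> 'o \<Rightarrow> ('i \<Rightarrow> 'm) \<Rightarrow> ('i \<Rightarrow> 'm) \<Rightarrow> bool" where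
  "is_biproduct C J X B \<iota> \<pi> \<longleftrightarrow> B \<in> Ob C \<and>
    (\<forall>j \<in> J. X j \<in> Ob C \<and> \<iota> j \<in> Hom C (X j) B \<and> \<pi> j \<in> Hom C B (X j)) \<and>
    (\<forall>j \<in> J. \<forall>k \<in> J. \<pi> k \<cdot>\<^bsub>C\<^esub> \<iota> j = (if j = k then Ident C (X j) else Zero C (X j) (X k))) \<and>
    hom_sum C B B (\<lambda>j. \<iota> j \<cdot>\<^bsub>C\<^esub> \<pi> j) J = Ident C B"

definition direct_summand :: "('o, 'm) cat \<Rightarrow> 'o \<Rightarrow> 'o \<Rightarrow> bool" where
  "direct_summand C X Z \<longleftrightarrow>
    (\<exists>Y \<iota> \<pi>. is_biproduct C {0, 1::nat} (\<lambda>k. if k = 0 then X else Y) Z \<iota> \<pi>)"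

definition is_kernel :: "('o, 'm) cat \<Rightarrow> 'm \<Rightarrow> 'm \<Rightarrow> bool" where
  "is_kernel C f k \<longleftrightarrow> f \<in> Ar C \<and> k \<in> Ar C \<and> Cod C k = Dom C f \<and>
    f \<cdot>\<^bsub>C\<^esub> k = Zero C (Dom C k) (Cod C f) \<and>
    (\<forall>W. \<forall>h \<in> Hom C W (Dom C f). f \<cdot>\<^bsub>C\<^esub> h = Zero C W (Cod C f) \<longrightarrow>
      (\<exists>!u. u \<in> Hom C W (Dom C k) \<and> k \<cdot>\<^bsub>C\<^esub> u = h))"

definition is_cokernel :: "('o, 'm) cat \<Rightarrow> 'm \<Rightarrow> 'm \<Rightarrow> bool" where
  "is_cokernel C f q \<longleftrightarrow> f \<in> Ar C \<and> q \<in> Ar C \<and> Dom C q = Cod C f \<and>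
    q \<cdot>\<^bsub>C\<^esub> f = Zero C (Dom C f) (Cod C q) \<and>
    (\<forall>W. \<forall>h \<in> Hom C (Cod C f) W. h \<cdot>\<^bsub>C\<^esub> f = Zero C (Dom C f) W \<longrightarrow>
      (\<exists>!u. u \<in> Hom C (Cod C q) W \<and> u \<cdot>\<^bsub>C\<^esub> q = h))"

locale abelian_category = preadditive_category +
  assumes biproducts_exist:
      "\<lbrakk>finite (J :: nat set); \<And>j. j \<in> J \<Longrightarrow> X j \<in> Ob C\<rbrakk> \<Longrightarrow>
        \<exists>B \<iota> \<pi>. is_biproduct C J X B \<iota> \<pi>"
    and kernels_exist: "f \<in> Ar C \<Longrightarrow> \<exists>k. is_kernel C f k"
    and cokernels_exist: "f \<in> Ar C \<Longrightarrow> \<exists>q. is_cokernel C f q"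
    and mono_is_kernel: "is_mono C k \<Longrightarrow> \<exists>f. is_kernel C f k"
    and epi_is_cokernel: "is_epi C q \<Longrightarrow> \<exists>f. is_cokernel C f q"

text \<open>
  Exactness of \<open>X \<rightarrow> Y \<rightarrow> Z\<close> at \<open>Y\<close>: the image of \<open>f\<close>, i.e. the kernel \<open>m\<close> of its cokernel \<open>q\<close>,
  is the kernel of \<open>g\<close>.
\<close>

definition exact_at :: "('o, 'm) cat \<Rightarrow> 'm \<Rightarrow> 'm \<Rightarrow> bool" where
  "exact_at C f g \<longleftrightarrow> (\<exists>q m. is_cokernel C f q \<and> is_kernel C q m \<and> is_kernel C g m)"


section \<open>Functors\<close>

record ('o, 'm, 'p, 'q) func =
  FOb :: "'o \<Rightarrow> 'p"
  FAr :: "'m \<Rightarrow> 'q"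

definition is_functor :: "('o, 'm) cat \<Rightarrow> ('p, 'q) cat \<Rightarrow> ('o, 'm, 'p, 'q) func \<Rightarrow> bool" where
  "is_functor C D F \<longleftrightarrow>
    (\<forall>X \<in> Ob C. FOb F X \<in> Ob D \<and> FAr F (Ident C X) = Ident D (FOb F X)) \<and>
    (\<forall>X Y. \<forall>f \<in> Hom C X Y. FAr F f \<in> Hom D (FOb F X) (FOb F Y)) \<and>
    (\<forall>X Y Z. \<forall>f \<in> Hom C X Y. \<forall>g \<in> Hom C Y Z. FAr F (g \<cdot>\<^bsub>C\<^esub> f) = FAr F g \<cdot>\<^bsub>D\<^esub> FAr F f)"

definition func_comp ::
  "('p, 'q, 'r, 's) func \<Rightarrow> ('o, 'm, 'p, 'q) func \<Rightarrow> ('o, 'm, 'r, 's) func" where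
  "func_comp G F = \<lparr>FOb = FOb G \<circ> FOb F, FAr = FAr G \<circ> FAr F\<rparr>"

definition is_nat_trans ::
  "('o, 'm) cat \<Rightarrow> ('p, 'q) cat \<Rightarrow> ('o, 'm, 'p, 'q) func \<Rightarrow> ('o, 'm, 'p, 'q) func \<Rightarrow>
    ('o \<Rightarrow> 'q) \<Rightarrow> bool" where
  "is_nat_trans C D F G \<eta> \<longleftrightarrow>
    (\<forall>X \<in> Ob C. \<eta> X \<in> Hom D (FOb F X) (FOb G X)) \<and>
    (\<forall>X Y. \<forall>f \<in> Hom C X Y. \<eta> Y \<cdot>\<^bsub>D\<^esub> FAr F f = FAr G f \<cdot>\<^bsub>D\<^esub> \<eta> X)"

definition additive_functor :: "('o, 'm) cat \<Rightarrow> ('p, 'q) cat \<Rightarrow> ('o, 'm, 'p, 'q) func \<Rightarrow> bool" where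
  "additive_functor C D F \<longleftrightarrow> is_functor C D F \<and>
    (\<forall>X Y. \<forall>f \<in> Hom C X Y. \<forall>g \<in> Hom C X Y. FAr F (Add C f g) = Add D (FAr F f) (FAr F g))"

text \<open>Exact sequences \<open>X \<rightarrow> Y \<rightarrow> Z \<rightarrow> 0\<close> go to exact sequences.\<close>

definition right_exact :: "('o, 'm) cat \<Rightarrow> ('p, 'q) cat \<Rightarrow> ('o, 'm, 'p, 'q) func \<Rightarrow> bool" where
  "right_exact C D F \<longleftrightarrow> (\<forall>f g. exact_at C f g \<and> is_epi C g \<longrightarrow>
    exact_at D (FAr F f) (FAr F g) \<and> is_epi D (FAr F g))"

text \<open>
  \<open>\<phi> X Y\<close> is the adjunction bijection from \<open>Hom D (F X) Y\<close> to \<open>Hom C X (G Y)\<close>; the last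
  conjunct is its naturality in both variables.
\<close>

definition is_adjunction ::
  "('o, 'm) cat \<Rightarrow> ('p, 'q) cat \<Rightarrow> ('o, 'm, 'p, 'q) func \<Rightarrow> ('p, 'q, 'o, 'm) func \<Rightarrow>
    ('o \<Rightarrow> 'p \<Rightarrow> 'q \<Rightarrow> 'm) \<Rightarrow> bool" where
  "is_adjunction C D F G \<phi> \<longleftrightarrow> is_functor C D F \<and> is_functor D C G \<and>
    (\<forall>X \<in> Ob C. \<forall>Y \<in> Ob D. bij_betw (\<phi> X Y) (Hom D (FOb F X) Y) (Hom C X (FOb G Y))) \<and>
    (\<forall>X \<in> Ob C. \<forall>X' \<in> Ob C. \<forall>Y \<in> Ob D. \<forall>Y' \<in> Ob D.
      \<forall>u \<in> Hom C X' X. \<forall>v \<in> Hom D Y Y'. \<forall>h \<in> Hom D (FOb F X) Y.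
        \<phi> X' Y' (v \<cdot>\<^bsub>D\<^esub> (h \<cdot>\<^bsub>D\<^esub> FAr F u)) = FAr G v \<cdot>\<^bsub>C\<^esub> (\<phi> X Y h \<cdot>\<^bsub>C\<^esub> u))"

definition has_right_adjoint :: "('o, 'm) cat \<Rightarrow> ('p, 'q) cat \<Rightarrow> ('o, 'm, 'p, 'q) func \<Rightarrow> bool" where
  "has_right_adjoint C D F \<longleftrightarrow> (\<exists>G \<phi>. is_adjunction C D F G \<phi>)"


section \<open>The right \<open>n\<close>-trivial extension\<close>

definition nat_trans_family ::
  "('o, 'm) cat \<Rightarrow> nat \<Rightarrow> (nat \<Rightarrow> ('o, 'm, 'o, 'm) func) \<Rightarrow> (nat \<Rightarrow> nat \<Rightarrow> 'o \<Rightarrow> 'm) \<Rightarrow> bool" where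
  "nat_trans_family A n F \<Phi> \<longleftrightarrow>
    (\<forall>i \<in> {1..n}. \<forall>j \<in> {1..n}. i + j \<in> {1..n} \<longrightarrow>
      is_nat_trans A A (func_comp (F i) (F j)) (F (i + j)) (\<Phi> i j))"

definition associative_family ::
  "('o, 'm) cat \<Rightarrow> nat \<Rightarrow> (nat \<Rightarrow> ('o, 'm, 'o, 'm) func) \<Rightarrow> (nat \<Rightarrow> nat \<Rightarrow> 'o \<Rightarrow> 'm) \<Rightarrow> bool" where
  "associative_family A n F \<Phi> \<longleftrightarrow>
    (\<forall>X \<in> Ob A. \<forall>i \<in> {1..n}. \<forall>j \<in> {1..n}. \<forall>k \<in> {1..n}. i + j + k \<in> {1..n} \<longrightarrow>
      \<Phi> i (j + k) X \<cdot>\<^bsub>A\<^esub> FAr (F i) (\<Phi> j k X) = \<Phi> (i + j) k X \<cdot>\<^bsub>A\<^esub> \<Phi> i j (FOb (F k) X))"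

text \<open>
  The structure maps of an object are functions on \<open>{1..n}\<close> (\<open>undefined\<close> elsewhere), so that
  equality of objects is equality of families.
\<close>

definition ext_objects ::
  "('o, 'm) cat \<Rightarrow> nat \<Rightarrow> (nat \<Rightarrow> ('o, 'm, 'o, 'm) func) \<Rightarrow> (nat \<Rightarrow> nat \<Rightarrow> 'o \<Rightarrow> 'm) \<Rightarrow>
    ('o \<times> (nat \<Rightarrow> 'm)) set" where
  "ext_objects A n F \<Phi> = {(X, f). X \<in> Ob A \<and> f \<in> (\<Pi>\<^sub>E i \<in> {1..n}. Hom A (FOb (F i) X) X) \<and>
    (\<forall>i \<in> {1..n}. \<forall>j \<in> {1..n}. f i \<cdot>\<^bsub>A\<^esub> FAr (F i) (f j) =
      (if i + j \<le> n then f (i + j) \<cdot>\<^bsub>A\<^esub> \<Phi> i j X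
       else Zero A (FOb (F i) (FOb (F j) X)) X))}"

text \<open>
  An arrow is a triple of source, target and the underlying arrow \<open>\<gamma>\<close>, as the same \<open>\<gamma>\<close> may be
  a morphism between different pairs of objects.
\<close>

definition trivial_extension ::
  "('o, 'm) cat \<Rightarrow> nat \<Rightarrow> (nat \<Rightarrow> ('o, 'm, 'o, 'm) func) \<Rightarrow> (nat \<Rightarrow> nat \<Rightarrow> 'o \<Rightarrow> 'm) \<Rightarrow>
    ('o \<times> (nat \<Rightarrow> 'm), ('o \<times> (nat \<Rightarrow> 'm)) \<times> ('o \<times> (nat \<Rightarrow> 'm)) \<times> 'm) cat" where
  "trivial_extension A n F \<Phi> =
    \<lparr>Ob = ext_objects A n F \<Phi>,
     Ar = {((X, \<alpha>), (Y, \<beta>), \<gamma>). (X, \<alpha>) \<in> ext_objects A n F \<Phi> \<and> (Y, \<beta>) \<in> ext_objects A n F \<Phi> \<and>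
       \<gamma> \<in> Hom A X Y \<and> (\<forall>i \<in> {1..n}. \<gamma> \<cdot>\<^bsub>A\<^esub> \<alpha> i = \<beta> i \<cdot>\<^bsub>A\<^esub> FAr (F i) \<gamma>)},
     Dom = (\<lambda>(S, S', \<gamma>). S),
     Cod = (\<lambda>(S, S', \<gamma>). S'),
     Ident = (\<lambda>(X, \<alpha>). ((X, \<alpha>), (X, \<alpha>), Ident A X)),
     Comp = (\<lambda>(R, R', \<delta>) (S, S', \<gamma>). (S, R', \<delta> \<cdot>\<^bsub>A\<^esub> \<gamma>)),
     Add = (\<lambda>(S, S', \<gamma>) (R, R', \<delta>). (S, S', Add A \<gamma> \<delta>)),
     Zero = (\<lambda>(X, \<alpha>) (Y, \<beta>). ((X, \<alpha>), (Y, \<beta>), Zero A X Y))\<rparr>"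


section \<open>The functors \<open>T\<close> and \<open>C\<close> on objects\<close>

text \<open>
  Direct sums and cokernels are only determined up to isomorphism; \<open>SOME\<close> fixes a choice.
\<close>

definition biproduct ::
  "('o, 'm) cat \<Rightarrow> 'i set \<Rightarrow> ('i \<Rightarrow> 'o) \<Rightarrow> 'o \<times> ('i \<Rightarrow> 'm) \<times> ('i \<Rightarrow> 'm)" where
  "biproduct C J X = (SOME (B, \<iota>, \<pi>). is_biproduct C J X B \<iota> \<pi>)"

definition coker :: "('o, 'm) cat \<Rightarrow> 'm \<Rightarrow> 'o" where
  "coker C f = Cod C (SOME q. is_cokernel C f q)"

text \<open>
  Summand \<open>0\<close> of \<open>B\<close> is \<open>X\<close> and summand \<open>j \<ge> 1\<close> is \<open>F\<^sub>j X\<close>. As \<open>F\<^sub>i\<close> is additive, \<open>F\<^sub>i B\<close> is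
  the direct sum of \<open>F\<^sub>i X\<close> and the \<open>F\<^sub>i F\<^sub>j X\<close>, with projections \<open>F\<^sub>i (\<pi> 0)\<close> and \<open>F\<^sub>i (\<pi> j)\<close>;
  \<open>\<kappa>\<^sub>i\<close> is the sum of its nonzero matrix entries.
\<close>

definition T_ob ::
  "('o, 'm) cat \<Rightarrow> nat \<Rightarrow> (nat \<Rightarrow> ('o, 'm, 'o, 'm) func) \<Rightarrow> (nat \<Rightarrow> nat \<Rightarrow> 'o \<Rightarrow> 'm) \<Rightarrow>
    'o \<Rightarrow> 'o \<times> (nat \<Rightarrow> 'm)" where
  "T_ob A n F \<Phi> X =
    (case biproduct A {0..n} (\<lambda>j. if j = 0 then X else FOb (F j) X) of (B, \<iota>, \<pi>) \<Rightarrow>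
      (B, \<lambda>i \<in> {1..n}. Add A
        (\<iota> i \<cdot>\<^bsub>A\<^esub> FAr (F i) (\<pi> 0))
        (hom_sum A (FOb (F i) B) B
          (\<lambda>j. \<iota> (i + j) \<cdot>\<^bsub>A\<^esub> (\<Phi> i j X \<cdot>\<^bsub>A\<^esub> FAr (F i) (\<pi> j)))
          {j \<in> {1..n}. i + j \<le> n})))"

text \<open>The argument of \<open>coker\<close> is the row \<open>(f\<^sub>i)\<^sub>i\<close> out of the direct sum \<open>S\<close> of the \<open>F\<^sub>i X\<close>.\<close>

definition C_ob ::
  "('o, 'm) cat \<Rightarrow> nat \<Rightarrow> (nat \<Rightarrow> ('o, 'm, 'o, 'm) func) \<Rightarrow> 'o \<times> (nat \<Rightarrow> 'm) \<Rightarrow> 'o" where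
  "C_ob A n F = (\<lambda>(X, f).
    (case biproduct A {1..n} (\<lambda>i. FOb (F i) X) of (S, \<iota>, \<pi>) \<Rightarrow>
      coker A (hom_sum A S X (\<lambda>i. f i \<cdot>\<^bsub>A\<^esub> \<pi> i) {1..n})))"

end

theory Submission
  imports Defs
begin

text \<open>
  \<open>T\<close> is left adjoint to the forgetful functor, which preserves epimorphisms because cokernels in
  the extension are computed in \<open>\<A>\<close>, the \<open>F\<^sub>i\<close> being right exact. Hence \<open>T\<close> preserves
  projectives, and a projective \<open>(X, f)\<close> is a retract of \<open>T P\<close> for any epimorphism \<open>P \<rightarrow> X\<close>.
  Moreover \<open>Q = C(X, f)\<close> is then projective, as \<open>C\<close> is left adjoint to \<open>Y \<mapsto> (Y, 0)\<close>, and a section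
  \<open>Q \<rightarrow> X\<close> extends to \<open>\<phi> : T Q \<rightarrow> (X, f)\<close> inducing an isomorphism of cokernels. By a form of
  Nakayama's lemma \<open>\<phi>\<close> is an epimorphism, so it has a section; the section again induces
  an isomorphism of cokernels, hence is an epimorphism and \<open>\<phi>\<close> is invertible.
\<close>

section \<open>Preadditive and abelian categories\<close>

text \<open>In the locales below the base category is \<open>C\<close>, while the functor C is
  \<open>C_ob\<close>. The extension is not shown to be abelian: its arrows are handled as arrows of
  \<open>C\<close> subject to \<open>E_map\<close>, and kernels and cokernels are formed in
  \<open>C\<close>, with a structure constructed on them where one is required. Lifting in the
  extension quantifies over the epimorphisms of the extension, so these have to be compared with
  those of \<open>C\<close> in both directions.

  The \<open>F i\<close> are only right exact, so injectivity of \<phi> is not approached through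
  kernels. A section \<psi> of \<phi> is a split monomorphism, hence invertible as soon as it is an
  epimorphism, and for that the Nakayama argument can be used a second time. The argument uses the
  cokernel of the row only through its universal property and that of its images under the
  \<open>F i\<close>, which is what \<open>row_cokernel\<close> records. For \<open>T P\<close> the
  row reaches exactly the summands of index at least 1, so its cokernel is the projection onto
  \<open>P\<close>.\<close>

context category
begin

lemma Hom_iff: "f \<in> Hom C X Y \<longleftrightarrow> f \<in> Ar C \<and> Dom C f = X \<and> Cod C f = Y"
  by (simp add: Hom_def)

lemma Dom_Ob [simp]: "f \<in> Ar C \<Longrightarrow> Dom C f \<in> Ob C"
  and Cod_Ob [simp]: "f \<in> Ar C \<Longrightarrow> Cod C f \<in> Ob C"
  by (fact Dom_in_Ob, fact Cod_in_Ob)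

lemma Hom_Ob: "f \<in> Hom C X Y \<Longrightarrow> X \<in> Ob C" "f \<in> Hom C X Y \<Longrightarrow> Y \<in> Ob C"
  by (auto simp: Hom_iff)

lemma Ident_typing [simp]:
  assumes "X \<in> Ob C"
  shows "Ident C X \<in> Ar C" "Dom C (Ident C X) = X" "Cod C (Ident C X) = X"
  using Ident_in_Hom[OF assms] by (auto simp: Hom_iff)

text \<open>Typing goes through \<open>Ar\<close>, \<open>Dom\<close> and \<open>Cod\<close> instead
  of \<open>Hom\<close>, so that the simplifier can discharge the conditions without guessing the
  objects in between.\<close>

lemma Comp_typing [simp]:
  assumes "f \<in> Ar C" "g \<in> Ar C" "Dom C g = Cod C f"
  shows "g \<cdot> f \<in> Ar C" "Dom C (g \<cdot> f) = Dom C f" "Cod C (g \<cdot> f) = Cod C g"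
  using Comp_in_Hom[of f "Dom C f" "Cod C f" g "Cod C g"] assms by (auto simp: Hom_iff)

lemma Comp_assoc' [simp]:
  assumes "f \<in> Ar C" "g \<in> Ar C" "h \<in> Ar C" "Dom C g = Cod C f" "Dom C h = Cod C g"
  shows "(h \<cdot> g) \<cdot> f = h \<cdot> (g \<cdot> f)"
  using Comp_assoc[of f "Dom C f" "Cod C f" g "Cod C g" h "Cod C h"] assms
  by (auto simp: Hom_iff)

lemma Comp_Ident' [simp]:
  assumes "f \<in> Ar C"
  shows "Dom C f = X \<Longrightarrow> f \<cdot> Ident C X = f" "Cod C f = Y \<Longrightarrow> Ident C Y \<cdot> f = f"
  using Comp_Ident_right Comp_Ident_left assms by (auto simp: Hom_iff)

text \<open>The simplifier associates composites to the right, which hides a known product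
  \<open>a \<cdot> b\<close> inside \<open>a \<cdot> (b \<cdot> x)\<close>; this makes the equation
  applicable again.\<close>

lemma Comp_reduce:
  assumes "a \<cdot> b = c" "a \<in> Ar C" "b \<in> Ar C" "x \<in> Ar C" "Dom C a = Cod C b" "Dom C b = Cod C x"
  shows "a \<cdot> (b \<cdot> x) = c \<cdot> x"
  using assms Comp_assoc' by metis

lemma is_epiD:
  assumes "is_epi C e" "g \<cdot> e = h \<cdot> e" "g \<in> Ar C" "h \<in> Ar C"
    "Dom C g = Cod C e" "Dom C h = Cod C e" "Cod C g = Cod C h"
  shows "g = h"
  using assms unfolding is_epi_def Hom_def by auto

lemma is_monoD:
  assumes "is_mono C m" "m \<cdot> g = m \<cdot> h" "g \<in> Ar C" "h \<in> Ar C"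
    "Cod C g = Dom C m" "Cod C h = Dom C m" "Dom C g = Dom C h"
  shows "g = h"
  using assms unfolding is_mono_def Hom_def by auto

lemma is_epi_Ar: "is_epi C e \<Longrightarrow> e \<in> Ar C"
  by (simp add: is_epi_def)

lemma is_epi_if_Comp:
  assumes gf: "is_epi C (g \<cdot> f)" and A: "f \<in> Ar C" "g \<in> Ar C" "Dom C g = Cod C f"
  shows "is_epi C g"
  unfolding is_epi_def
proof (intro conjI allI ballI impI)
  fix W a b
  assume "a \<in> Hom C (Cod C g) W" "b \<in> Hom C (Cod C g) W" and e: "a \<cdot> g = b \<cdot> g"
  then have ab: "a \<in> Ar C" "b \<in> Ar C" "Dom C a = Cod C g" "Dom C b = Cod C g" "Cod C a = Cod C b"
    by (auto simp: Hom_iff)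
  have "a \<cdot> g \<cdot> f = b \<cdot> g \<cdot> f"
    using e A ab by (metis Comp_assoc')
  then show "a = b"
    by (rule is_epiD[OF gf]) (use A ab in auto)
qed (use A in auto)

lemma is_epi_Ident: "X \<in> Ob C \<Longrightarrow> is_epi C (Ident C X)"
  unfolding is_epi_def by (auto simp: Hom_iff)

text \<open>Lift \<open>g \<cdot> r\<close> along \<open>e\<close> and restrict the lift along
  \<open>i\<close>. Only the category axioms are assumed, because the lemma is applied to the
  extension.\<close>

lemma projective_retract:
  assumes P: "projective C P" and i: "i \<in> Hom C X P" and r: "r \<in> Hom C P X"
    and ri: "r \<cdot> i = Ident C X"
  shows "projective C X"
  unfolding projective_def
proof (intro conjI allI impI ballI)
  show "X \<in> Ob C" using i by (rule Hom_Ob)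
  fix e g assume e: "is_epi C e" and g: "g \<in> Hom C X (Cod C e)"
  have "g \<cdot> r \<in> Hom C P (Cod C e)" using g r by (simp add: Hom_iff)
  then obtain h where h: "h \<in> Hom C P (Dom C e)" "e \<cdot> h = g \<cdot> r"
    using P e unfolding projective_def by blast
  have "e \<cdot> (h \<cdot> i) = (e \<cdot> h) \<cdot> i"
    using h(1) i is_epi_Ar[OF e] by (simp add: Hom_iff)
  also have "\<dots> = g \<cdot> (r \<cdot> i)" using h g r i by (simp add: Hom_iff)
  also have "\<dots> = g" using ri g by (simp add: Hom_iff)
  finally show "\<exists>h\<in>Hom C X (Dom C e). e \<cdot> h = g"
    using h(1) i by (intro bexI[of _ "h \<cdot> i"]) (auto simp: Hom_iff)
qed

end

section \<open>Addition and zero arrows\<close>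

context preadditive_category
begin

lemma hom_group_simps [simp]:
  "carrier (hom_group C X Y) = Hom C X Y"
  "mult (hom_group C X Y) = Add C"
  "one (hom_group C X Y) = Zero C X Y"
  by (simp_all add: hom_group_def)

lemma Zero_typing [simp]:
  assumes "X \<in> Ob C" "Y \<in> Ob C"
  shows "Zero C X Y \<in> Ar C" "Dom C (Zero C X Y) = X" "Cod C (Zero C X Y) = Y"
proof -
  interpret G: comm_group "hom_group C X Y" by (rule hom_comm_group[OF assms])
  show "Zero C X Y \<in> Ar C" "Dom C (Zero C X Y) = X" "Cod C (Zero C X Y) = Y"
    using G.one_closed by (auto simp: Hom_iff)
qed

lemma Add_typing [simp]:
  assumes "f \<in> Ar C" "g \<in> Ar C" "Dom C f = Dom C g" "Cod C f = Cod C g"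
  shows "Add C f g \<in> Ar C" "Dom C (Add C f g) = Dom C g" "Cod C (Add C f g) = Cod C g"
proof -
  interpret G: comm_group "hom_group C (Dom C g) (Cod C g)"
    by (rule hom_comm_group) (use assms in auto)
  show "Add C f g \<in> Ar C" "Dom C (Add C f g) = Dom C g" "Cod C (Add C f g) = Cod C g"
    using G.m_closed[of f g] assms by (auto simp: Hom_iff)
qed

lemma Add_Zero [simp]:
  assumes "f \<in> Ar C" "Dom C f = X" "Cod C f = Y"
  shows "Add C f (Zero C X Y) = f" "Add C (Zero C X Y) f = f"
proof -
  interpret G: comm_group "hom_group C X Y"
    by (rule hom_comm_group) (use assms in auto)
  show "Add C f (Zero C X Y) = f" "Add C (Zero C X Y) f = f"
    using G.r_one[of f] G.l_one[of f] assms by (auto simp: Hom_iff)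
qed

lemma Add_commute:
  assumes "f \<in> Hom C X Y" "g \<in> Hom C X Y"
  shows "Add C f g = Add C g f"
proof -
  interpret G: comm_group "hom_group C X Y"
    by (rule hom_comm_group) (use assms in \<open>auto simp: Hom_Ob\<close>)
  show ?thesis using G.m_comm[of f g] assms by auto
qed

lemma Add_assoc:
  assumes "f \<in> Hom C X Y" "g \<in> Hom C X Y" "h \<in> Hom C X Y"
  shows "Add C (Add C f g) h = Add C f (Add C g h)"
proof -
  interpret G: comm_group "hom_group C X Y"
    by (rule hom_comm_group) (use assms in \<open>auto simp: Hom_Ob\<close>)
  show ?thesis using G.m_assoc[of f g h] assms by auto
qed

lemma Add_right_cancel:
  assumes "f \<in> Hom C X Y" "g \<in> Hom C X Y" "h \<in> Hom C X Y" "Add C f h = Add C g h"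
  shows "f = g"
proof -
  interpret G: comm_group "hom_group C X Y"
    by (rule hom_comm_group) (use assms in \<open>auto simp: Hom_Ob\<close>)
  show ?thesis using G.right_cancel[of h f g] assms by auto
qed

lemma Add_inverse_exists:
  assumes "f \<in> Hom C X Y"
  obtains g where "g \<in> Hom C X Y" "Add C f g = Zero C X Y"
proof -
  interpret G: comm_group "hom_group C X Y"
    by (rule hom_comm_group) (use assms in \<open>auto simp: Hom_Ob\<close>)
  show ?thesis using that G.r_inv_ex[of f] assms by auto
qed

text \<open>\<open>Zero\<close> is constrained only as the neutral element of each hom group. A
  composite with a zero arrow is idempotent under \<open>Add\<close> by distributivity, so this is
  how such composites are seen to vanish.\<close>

lemma Add_idem_Zero:
  assumes "f \<in> Hom C X Y" "Add C f f = f"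
  shows "f = Zero C X Y"
  by (rule Add_right_cancel[OF assms(1) _ assms(1)]) (use assms in \<open>auto simp: Hom_iff\<close>)

lemma Comp_Zero [simp]:
  assumes "g \<in> Ar C" "Dom C g = Y" "X \<in> Ob C"
  shows "g \<cdot> Zero C X Y = Zero C X (Cod C g)"
proof (rule Add_idem_Zero)
  have z: "Zero C X Y \<in> Hom C X Y" using assms by (auto simp: Hom_iff)
  show "g \<cdot> Zero C X Y \<in> Hom C X (Cod C g)" using assms by (auto simp: Hom_iff)
  show "Add C (g \<cdot> Zero C X Y) (g \<cdot> Zero C X Y) = g \<cdot> Zero C X Y"
    using Comp_Add_right[OF z z, of g "Cod C g"] assms by (auto simp: Hom_iff)
qed

lemma Zero_Comp [simp]:
  assumes "f \<in> Ar C" "Cod C f = Y" "Z \<in> Ob C"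
  shows "Zero C Y Z \<cdot> f = Zero C (Dom C f) Z"
proof (rule Add_idem_Zero)
  have z: "Zero C Y Z \<in> Hom C Y Z" using assms by (auto simp: Hom_iff)
  show "Zero C Y Z \<cdot> f \<in> Hom C (Dom C f) Z" using assms by (auto simp: Hom_iff)
  show "Add C (Zero C Y Z \<cdot> f) (Zero C Y Z \<cdot> f) = Zero C Y Z \<cdot> f"
    using Comp_Add_left[OF _ z z, of f "Dom C f"] assms by (auto simp: Hom_iff)
qed

lemma Comp_Add_right':
  assumes "f \<in> Ar C" "f' \<in> Ar C" "g \<in> Ar C" "Dom C f = Dom C f'"
    "Cod C f = Dom C g" "Cod C f' = Dom C g"
  shows "g \<cdot> Add C f f' = Add C (g \<cdot> f) (g \<cdot> f')"
  by (rule Comp_Add_right[of _ "Dom C f'" "Dom C g" _ _ "Cod C g"]) (use assms in \<open>auto simp: Hom_iff\<close>)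

lemma Comp_Add_left':
  assumes "f \<in> Ar C" "g \<in> Ar C" "g' \<in> Ar C" "Cod C g = Cod C g'"
    "Cod C f = Dom C g" "Cod C f = Dom C g'"
  shows "Add C g g' \<cdot> f = Add C (g \<cdot> f) (g' \<cdot> f)"
  by (rule Comp_Add_left[of _ "Dom C f" "Dom C g" _ "Cod C g"]) (use assms in \<open>auto simp: Hom_iff\<close>)

text \<open>Apply the test to the difference of two arrows that agree after \<open>e\<close>; the
  record has no subtraction, so an additive inverse \<open>k\<close> of \<open>h\<close> takes its
  place.\<close>

lemma is_epiI_Zero:
  assumes e: "e \<in> Ar C"
    and z: "\<And>h. \<lbrakk>h \<in> Ar C; Dom C h = Cod C e; h \<cdot> e = Zero C (Dom C e) (Cod C h)\<rbrakk>
      \<Longrightarrow> h = Zero C (Cod C e) (Cod C h)"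
  shows "is_epi C e"
  unfolding is_epi_def
proof (intro conjI allI ballI impI)
  fix W g h
  assume g: "g \<in> Hom C (Cod C e) W" and h: "h \<in> Hom C (Cod C e) W" and gh: "g \<cdot> e = h \<cdot> e"
  obtain k where k: "k \<in> Hom C (Cod C e) W" "Add C h k = Zero C (Cod C e) W"
    using Add_inverse_exists[OF h] .
  have "Add C g k \<cdot> e = Add C h k \<cdot> e"
    using g h k(1) e gh by (simp add: Comp_Add_left' Hom_iff)
  also have "\<dots> = Zero C (Dom C e) W" using k e by (auto simp: Hom_iff)
  finally have "Add C g k = Zero C (Cod C e) W"
    using z[of "Add C g k"] g k(1) e by (simp add: Hom_iff)
  then show "g = h"
    using Add_right_cancel[OF g h k(1)] k(2) by simp
qed (fact e)

lemma is_epi_Zero: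
  assumes "is_epi C e" "h \<cdot> e = Zero C (Dom C e) (Cod C h)" "h \<in> Ar C" "Dom C h = Cod C e"
  shows "h = Zero C (Cod C e) (Cod C h)"
  by (rule is_epiD[OF assms(1)]) (use assms is_epi_Ar[OF assms(1)] in auto)

section \<open>Finite sums of arrows\<close>

lemma hom_sum_empty [simp]:
  assumes "X \<in> Ob C" "Y \<in> Ob C"
  shows "hom_sum C X Y f {} = Zero C X Y"
proof -
  interpret G: comm_group "hom_group C X Y" by (rule hom_comm_group[OF assms])
  show ?thesis by (simp add: hom_sum_def)
qed

lemma hom_sum_insert:
  assumes "finite J" "j \<notin> J" "X \<in> Ob C" "Y \<in> Ob C" "\<And>k. k \<in> insert j J \<Longrightarrow> f k \<in> Hom C X Y"
  shows "hom_sum C X Y f (insert j J) = Add C (f j) (hom_sum C X Y f J)"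
proof -
  interpret G: comm_group "hom_group C X Y" by (rule hom_comm_group[OF assms(3,4)])
  show ?thesis unfolding hom_sum_def
    using G.finprod_insert[of J j f] assms by auto
qed

lemma hom_sum_in_Hom:
  assumes "X \<in> Ob C" "Y \<in> Ob C" "\<And>k. k \<in> J \<Longrightarrow> f k \<in> Hom C X Y"
  shows "hom_sum C X Y f J \<in> Hom C X Y"
proof -
  interpret G: comm_group "hom_group C X Y" by (rule hom_comm_group[OF assms(1,2)])
  show ?thesis unfolding hom_sum_def
    using G.finprod_closed[of f J] assms by auto
qed

lemma hom_sum_cong:
  assumes "X \<in> Ob C" "Y \<in> Ob C" "\<And>k. k \<in> J \<Longrightarrow> f k \<in> Hom C X Y" "\<And>k. k \<in> J \<Longrightarrow> f k = g k"
  shows "hom_sum C X Y f J = hom_sum C X Y g J"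
proof -
  interpret G: comm_group "hom_group C X Y" by (rule hom_comm_group[OF assms(1,2)])
  show ?thesis unfolding hom_sum_def
    by (rule G.finprod_cong') (use assms in auto)
qed

lemma hom_sum_Zero:
  assumes "X \<in> Ob C" "Y \<in> Ob C" "\<And>k. k \<in> J \<Longrightarrow> f k = Zero C X Y"
  shows "hom_sum C X Y f J = Zero C X Y"
proof -
  interpret G: comm_group "hom_group C X Y" by (rule hom_comm_group[OF assms(1,2)])
  show ?thesis unfolding hom_sum_def
    using G.finprod_one_eqI[of J f] assms by auto
qed

lemma hom_sum_single:
  assumes J: "finite J" "k \<in> J" and k: "f k \<in> Hom C X Y"
    and z: "\<And>j. j \<in> J \<Longrightarrow> j \<noteq> k \<Longrightarrow> f j = Zero C X Y"
  shows "hom_sum C X Y f J = f k"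
proof -
  have O: "X \<in> Ob C" "Y \<in> Ob C" using k by (auto intro: Hom_Ob)
  have "J = insert k (J - {k})" using J by auto
  moreover have "hom_sum C X Y f (insert k (J - {k})) = Add C (f k) (hom_sum C X Y f (J - {k}))"
  proof (rule hom_sum_insert)
    show "f j \<in> Hom C X Y" if "j \<in> insert k (J - {k})" for j
      using that k z[of j] O by (cases "j = k") (auto simp: Hom_iff)
  qed (use J O in auto)
  moreover have "hom_sum C X Y f (J - {k}) = Zero C X Y"
    by (rule hom_sum_Zero) (use O z in auto)
  ultimately show ?thesis using k by (simp add: Hom_iff)
qed

lemma Comp_hom_sum:
  assumes "finite J" "X \<in> Ob C" "\<And>j. j \<in> J \<Longrightarrow> f j \<in> Hom C X Y" "g \<in> Hom C Y Z"
  shows "g \<cdot> hom_sum C X Y f J = hom_sum C X Z (\<lambda>j. g \<cdot> f j) J"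
  using assms(1,3)
proof (induction J rule: finite_induct)
  case empty
  then show ?case using assms by (auto simp: Hom_iff)
next
  case (insert j J)
  have O: "Y \<in> Ob C" "Z \<in> Ob C" using assms(4) by (auto intro: Hom_Ob)
  have "g \<cdot> hom_sum C X Y f (insert j J) = g \<cdot> Add C (f j) (hom_sum C X Y f J)"
    using insert O assms by (subst hom_sum_insert) auto
  also have "\<dots> = Add C (g \<cdot> f j) (g \<cdot> hom_sum C X Y f J)"
    by (rule Comp_Add_right[OF _ _ assms(4)]) (use insert O assms in \<open>auto intro!: hom_sum_in_Hom\<close>)
  also have "\<dots> = hom_sum C X Z (\<lambda>j. g \<cdot> f j) (insert j J)"
    using insert O assms by (subst hom_sum_insert) (auto intro: Comp_in_Hom)
  finally show ?case .
qed

lemma hom_sum_Comp: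
  assumes "finite J" "Z \<in> Ob C" "\<And>j. j \<in> J \<Longrightarrow> f j \<in> Hom C Y Z" "g \<in> Hom C X Y"
  shows "hom_sum C Y Z f J \<cdot> g = hom_sum C X Z (\<lambda>j. f j \<cdot> g) J"
  using assms(1,3)
proof (induction J rule: finite_induct)
  case empty
  then show ?case using assms by (auto simp add: Hom_iff)
next
  case (insert j J)
  have O: "X \<in> Ob C" "Y \<in> Ob C" using assms(4) by (auto intro: Hom_Ob)
  have "hom_sum C Y Z f (insert j J) \<cdot> g = Add C (f j) (hom_sum C Y Z f J) \<cdot> g"
    using insert O assms by (subst hom_sum_insert) auto
  also have "\<dots> = Add C (f j \<cdot> g) (hom_sum C Y Z f J \<cdot> g)"
    by (rule Comp_Add_left[OF assms(4)]) (use insert O assms in \<open>auto intro!: hom_sum_in_Hom\<close>)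
  also have "\<dots> = hom_sum C X Z (\<lambda>j. f j \<cdot> g) (insert j J)"
    using insert O assms by (subst hom_sum_insert) (auto intro: Comp_in_Hom)
  finally show ?case .
qed

section \<open>Additive functors\<close>

lemma additive_functor_Zero:
  assumes F: "additive_functor C D F" "preadditive_category D" and O: "X \<in> Ob C" "Y \<in> Ob C"
  shows "FAr F (Zero C X Y) = Zero D (FOb F X) (FOb F Y)"
proof -
  interpret D: preadditive_category D by fact
  have z: "Zero C X Y \<in> Hom C X Y" using O by (simp add: Hom_iff)
  show ?thesis
  proof (rule D.Add_idem_Zero)
    show "FAr F (Zero C X Y) \<in> Hom D (FOb F X) (FOb F Y)"
      using F z unfolding additive_functor_def is_functor_def by blast
    have "FAr F (Add C (Zero C X Y) (Zero C X Y)) = Add D (FAr F (Zero C X Y)) (FAr F (Zero C X Y))"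
      using F z unfolding additive_functor_def by blast
    then show "Add D (FAr F (Zero C X Y)) (FAr F (Zero C X Y)) = FAr F (Zero C X Y)"
      using O by simp
  qed
qed

lemma additive_functor_hom_sum:
  assumes F: "additive_functor C D F" "preadditive_category D"
    and J: "finite J" "X \<in> Ob C" "Y \<in> Ob C" "\<And>j. j \<in> J \<Longrightarrow> f j \<in> Hom C X Y"
  shows "FAr F (hom_sum C X Y f J) = hom_sum D (FOb F X) (FOb F Y) (\<lambda>j. FAr F (f j)) J"
  using J(1,4)
proof (induction J rule: finite_induct)
  case empty
  interpret D: preadditive_category D by fact
  have "FOb F X \<in> Ob D" "FOb F Y \<in> Ob D"
    using F(1) J(2,3) by (simp_all add: additive_functor_def is_functor_def)
  then show ?case using J(2,3) by (simp add: additive_functor_Zero[OF F J(2,3)])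
next
  case (insert j J)
  interpret D: preadditive_category D by fact
  have H: "FAr F u \<in> Hom D (FOb F X) (FOb F Y)" if "u \<in> Hom C X Y" for u
    using F that unfolding additive_functor_def is_functor_def by blast
  have O: "FOb F X \<in> Ob D" "FOb F Y \<in> Ob D"
    using F(1) J(2,3) by (simp_all add: additive_functor_def is_functor_def)
  have "FAr F (hom_sum C X Y f (insert j J)) = FAr F (Add C (f j) (hom_sum C X Y f J))"
    using insert J by (subst hom_sum_insert) auto
  also have "\<dots> = Add D (FAr F (f j)) (FAr F (hom_sum C X Y f J))"
  proof -
    have "f j \<in> Hom C X Y" "hom_sum C X Y f J \<in> Hom C X Y"
      using insert.prems hom_sum_in_Hom[OF J(2,3), of J f] by auto
    then show ?thesis using F(1) unfolding additive_functor_def by blast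
  qed
  also have "\<dots> = hom_sum D (FOb F X) (FOb F Y) (\<lambda>j. FAr F (f j)) (insert j J)"
    using insert O H by (subst D.hom_sum_insert) auto
  finally show ?case .
qed

section \<open>Biproducts\<close>

lemma biproduct_Hom:
  assumes "is_biproduct C J X B \<iota> \<pi>" "j \<in> J"
  shows "X j \<in> Ob C" "\<iota> j \<in> Hom C (X j) B" "\<pi> j \<in> Hom C B (X j)" "B \<in> Ob C"
  using assms unfolding is_biproduct_def by blast+

lemma biproduct_proj_inj:
  assumes "is_biproduct C J X B \<iota> \<pi>" "j \<in> J" "k \<in> J"
  shows "\<pi> k \<cdot> \<iota> j = (if j = k then Ident C (X j) else Zero C (X j) (X k))"
  using assms unfolding is_biproduct_def by blast

text \<open>Composing with the decomposition of the identity into the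
  \<open>\<iota> j \<cdot> \<pi> j\<close> recovers an arrow out of \<open>B\<close> from its
  restrictions to the summands.\<close>

lemma biproduct_ext:
  assumes B: "is_biproduct C J X B \<iota> \<pi>" and J: "finite J"
    and u: "u \<in> Hom C B Y" and v: "v \<in> Hom C B Y"
    and eq: "\<And>j. j \<in> J \<Longrightarrow> u \<cdot> \<iota> j = v \<cdot> \<iota> j"
  shows "u = v"
proof -
  have BO: "B \<in> Ob C" using u by (rule Hom_Ob)
  have H: "\<And>j. j \<in> J \<Longrightarrow> \<iota> j \<cdot> \<pi> j \<in> Hom C B B"
    using biproduct_Hom[OF B] by (blast intro: Comp_in_Hom)
  have *: "w = hom_sum C B Y (\<lambda>j. (w \<cdot> \<iota> j) \<cdot> \<pi> j) J" if w: "w \<in> Hom C B Y" for w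
  proof -
    have "w = w \<cdot> hom_sum C B B (\<lambda>j. \<iota> j \<cdot> \<pi> j) J"
      using B w unfolding is_biproduct_def by (simp add: Hom_iff)
    also have "\<dots> = hom_sum C B Y (\<lambda>j. w \<cdot> (\<iota> j \<cdot> \<pi> j)) J"
      by (rule Comp_hom_sum[OF J BO H w])
    also have "\<dots> = hom_sum C B Y (\<lambda>j. (w \<cdot> \<iota> j) \<cdot> \<pi> j) J"
    proof (rule hom_sum_cong)
      show "w \<cdot> \<iota> j \<cdot> \<pi> j = (w \<cdot> \<iota> j) \<cdot> \<pi> j" if "j \<in> J" for j
        using w biproduct_Hom[OF B that] by (simp add: Hom_iff)
      show "w \<cdot> \<iota> j \<cdot> \<pi> j \<in> Hom C B Y" if "j \<in> J" for j
        using w H[OF that] by (rule Comp_in_Hom[rotated])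
    qed (use w BO in \<open>auto simp: Hom_iff\<close>)
    finally show ?thesis .
  qed
  have "hom_sum C B Y (\<lambda>j. (u \<cdot> \<iota> j) \<cdot> \<pi> j) J = hom_sum C B Y (\<lambda>j. (v \<cdot> \<iota> j) \<cdot> \<pi> j) J"
  proof (rule hom_sum_cong)
    show "(u \<cdot> \<iota> j) \<cdot> \<pi> j \<in> Hom C B Y" if "j \<in> J" for j
      using u biproduct_Hom[OF B that] by (auto simp: Hom_iff)
  qed (use u eq in \<open>auto simp: Hom_iff\<close>)
  then show ?thesis using *[OF u] *[OF v] by simp
qed

lemma biproduct_copair:
  assumes B: "is_biproduct C J X B \<iota> \<pi>" and J: "finite J" and Y: "Y \<in> Ob C"
    and c: "\<And>j. j \<in> J \<Longrightarrow> c j \<in> Hom C (X j) Y"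
  defines "u \<equiv> hom_sum C B Y (\<lambda>j. c j \<cdot> \<pi> j) J"
  shows "u \<in> Hom C B Y" "\<And>j. j \<in> J \<Longrightarrow> u \<cdot> \<iota> j = c j"
proof -
  have BO: "B \<in> Ob C" using B unfolding is_biproduct_def by blast
  have H: "\<And>j. j \<in> J \<Longrightarrow> c j \<cdot> \<pi> j \<in> Hom C B Y"
    using biproduct_Hom[OF B] c by (blast intro: Comp_in_Hom)
  show "u \<in> Hom C B Y"
    unfolding u_def by (rule hom_sum_in_Hom[OF BO Y H])
  fix k assume k: "k \<in> J"
  have "u \<cdot> \<iota> k = hom_sum C (X k) Y (\<lambda>j. (c j \<cdot> \<pi> j) \<cdot> \<iota> k) J"
    unfolding u_def by (rule hom_sum_Comp[OF J Y H]) (use biproduct_Hom[OF B k] in auto)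
  also have "\<dots> = (c k \<cdot> \<pi> k) \<cdot> \<iota> k"
  proof (rule hom_sum_single[OF J k])
    show "(c k \<cdot> \<pi> k) \<cdot> \<iota> k \<in> Hom C (X k) Y"
      using biproduct_Hom[OF B k] c[OF k] by (auto simp: Hom_iff)
    fix j assume j: "j \<in> J" "j \<noteq> k"
    have "(c j \<cdot> \<pi> j) \<cdot> \<iota> k = c j \<cdot> (\<pi> j \<cdot> \<iota> k)"
      using biproduct_Hom[OF B k] biproduct_Hom[OF B j(1)] c[OF j(1)] by (simp add: Hom_iff)
    also have "\<dots> = Zero C (X k) Y"
      using biproduct_Hom[OF B k] biproduct_Hom[OF B j(1)] c[OF j(1)]
        biproduct_proj_inj[OF B k j(1)] j by (auto simp: Hom_iff)
    finally show "(c j \<cdot> \<pi> j) \<cdot> \<iota> k = Zero C (X k) Y" .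
  qed
  also have "\<dots> = c k \<cdot> (\<pi> k \<cdot> \<iota> k)"
    using biproduct_Hom[OF B k] c[OF k] by (simp add: Hom_iff)
  also have "\<dots> = c k"
    using biproduct_proj_inj[OF B k k] biproduct_Hom[OF B k] c[OF k] by (simp add: Hom_iff)
  finally show "u \<cdot> \<iota> k = c k" .
qed

text \<open>The conditions on a biproduct are equations between sums and composites, and an additive
  functor preserves these. Hence arrows out of \<open>FOb F B\<close> can be compared on the
  \<open>FAr F (\<iota> j)\<close>.\<close>

lemma additive_functor_biproduct:
  assumes F: "additive_functor C D F" "preadditive_category D"
    and J: "finite J" and B: "is_biproduct C J X B \<iota> \<pi>"
  shows "is_biproduct D J (\<lambda>j. FOb F (X j)) (FOb F B) (\<lambda>j. FAr F (\<iota> j)) (\<lambda>j. FAr F (\<pi> j))"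
proof -
  interpret D: preadditive_category D by fact
  have FH: "FAr F u \<in> Hom D (FOb F Y) (FOb F Z)" if "u \<in> Hom C Y Z" for u Y Z
    using F that unfolding additive_functor_def is_functor_def by blast
  have FO: "FOb F Y \<in> Ob D" "FAr F (Ident C Y) = Ident D (FOb F Y)" if "Y \<in> Ob C" for Y
    using F(1) that by (simp_all add: additive_functor_def is_functor_def)
  have FC: "FAr F (v \<cdot> u) = FAr F v \<cdot>\<^bsub>D\<^esub> FAr F u" if "u \<in> Hom C Y Z" "v \<in> Hom C Z W" for u v Y Z W
    using F that unfolding additive_functor_def is_functor_def by blast
  note bH = biproduct_Hom[OF B]
  have BO: "B \<in> Ob C" using B unfolding is_biproduct_def by blast
  show ?thesis
    unfolding is_biproduct_def
  proof (intro conjI ballI)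
    fix j k assume jk: "j \<in> J" "k \<in> J"
    have "FAr F (\<pi> k) \<cdot>\<^bsub>D\<^esub> FAr F (\<iota> j) = FAr F (\<pi> k \<cdot> \<iota> j)"
      using FC bH jk by metis
    then show "FAr F (\<pi> k) \<cdot>\<^bsub>D\<^esub> FAr F (\<iota> j) =
        (if j = k then Ident D (FOb F (X j)) else Zero D (FOb F (X j)) (FOb F (X k)))"
      using biproduct_proj_inj[OF B jk] FO(2) additive_functor_Zero[OF F] bH jk by auto
  next
    have H: "\<And>j. j \<in> J \<Longrightarrow> \<iota> j \<cdot> \<pi> j \<in> Hom C B B"
      using bH by (blast intro: Comp_in_Hom)
    have "hom_sum D (FOb F B) (FOb F B) (\<lambda>j. FAr F (\<iota> j) \<cdot>\<^bsub>D\<^esub> FAr F (\<pi> j)) J =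
        hom_sum D (FOb F B) (FOb F B) (\<lambda>j. FAr F (\<iota> j \<cdot> \<pi> j)) J"
    proof (rule D.hom_sum_cong)
      fix j assume j: "j \<in> J"
      show "FAr F (\<iota> j) \<cdot>\<^bsub>D\<^esub> FAr F (\<pi> j) \<in> Hom D (FOb F B) (FOb F B)"
        using FH[OF bH(2)[OF j]] FH[OF bH(3)[OF j]] by (rule D.Comp_in_Hom[rotated])
      show "FAr F (\<iota> j) \<cdot>\<^bsub>D\<^esub> FAr F (\<pi> j) = FAr F (\<iota> j \<cdot> \<pi> j)"
        using FC[OF bH(3)[OF j] bH(2)[OF j]] by simp
    qed (use FO(1) BO in auto)
    also have "\<dots> = FAr F (hom_sum C B B (\<lambda>j. \<iota> j \<cdot> \<pi> j) J)"
      using additive_functor_hom_sum[OF F J BO BO H] by simp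
    also have "\<dots> = Ident D (FOb F B)"
      using B FO(2)[OF BO] unfolding is_biproduct_def by simp
    finally show "hom_sum D (FOb F B) (FOb F B) (\<lambda>j. FAr F (\<iota> j) \<cdot>\<^bsub>D\<^esub> FAr F (\<pi> j)) J
        = Ident D (FOb F B)" .
  qed (use FO(1) BO bH FH in auto)
qed

section \<open>Kernels and cokernels\<close>

lemma is_cokernelD:
  assumes "is_cokernel C f q"
  shows "f \<in> Ar C" "q \<in> Ar C" "Dom C q = Cod C f" "q \<cdot> f = Zero C (Dom C f) (Cod C q)"
  using assms unfolding is_cokernel_def by blast+

lemma is_kernelD:
  assumes "is_kernel C f k"
  shows "f \<in> Ar C" "k \<in> Ar C" "Cod C k = Dom C f" "f \<cdot> k = Zero C (Dom C k) (Cod C f)"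
  using assms unfolding is_kernel_def by blast+

lemma is_cokernel_factor:
  assumes "is_cokernel C f q" "h \<in> Hom C (Cod C f) W" "h \<cdot> f = Zero C (Dom C f) W"
  obtains u where "u \<in> Hom C (Cod C q) W" "u \<cdot> q = h"
  using assms unfolding is_cokernel_def by blast

lemma is_kernel_factor:
  assumes "is_kernel C f k" "h \<in> Hom C W (Dom C f)" "f \<cdot> h = Zero C W (Cod C f)"
  obtains u where "u \<in> Hom C W (Dom C k)" "k \<cdot> u = h"
  using assms unfolding is_kernel_def by blast

lemma is_cokernel_epi:
  assumes q: "is_cokernel C f q"
  shows "is_epi C q"
proof (rule is_epiI_Zero)
  note d = is_cokernelD[OF q]
  show "q \<in> Ar C" by fact
  fix h assume h: "h \<in> Ar C" "Dom C h = Cod C q" "h \<cdot> q = Zero C (Dom C q) (Cod C h)"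
  have "Zero C (Dom C q) (Cod C h) \<in> Hom C (Cod C f) (Cod C h)"
    "Zero C (Dom C q) (Cod C h) \<cdot> f = Zero C (Dom C f) (Cod C h)"
    using d h by (auto simp: Hom_iff)
  then have "\<exists>!u. u \<in> Hom C (Cod C q) (Cod C h) \<and> u \<cdot> q = Zero C (Dom C q) (Cod C h)"
    using q unfolding is_cokernel_def by blast
  moreover have "h \<in> Hom C (Cod C q) (Cod C h)"
    "Zero C (Cod C q) (Cod C h) \<in> Hom C (Cod C q) (Cod C h)"
    "Zero C (Cod C q) (Cod C h) \<cdot> q = Zero C (Dom C q) (Cod C h)"
    using d h by (auto simp: Hom_iff)
  ultimately show "h = Zero C (Cod C q) (Cod C h)" using h(3) by metis
qed

lemma is_kernel_mono:
  assumes k: "is_kernel C f k"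
  shows "is_mono C k"
  unfolding is_mono_def
proof (intro conjI allI ballI impI)
  note d = is_kernelD[OF k]
  show "k \<in> Ar C" by fact
  fix W g h assume g: "g \<in> Hom C W (Dom C k)" and h: "h \<in> Hom C W (Dom C k)" and e: "k \<cdot> g = k \<cdot> h"
  have "f \<cdot> (k \<cdot> g) = (f \<cdot> k) \<cdot> g" using g d(1-3) by (simp add: Hom_iff)
  also have "\<dots> = Zero C W (Cod C f)" using g d by (auto simp: Hom_iff)
  finally have "f \<cdot> (k \<cdot> g) = Zero C W (Cod C f)" .
  moreover have "k \<cdot> g \<in> Hom C W (Dom C f)" using g d by (auto simp: Hom_iff)
  ultimately have "\<exists>!u. u \<in> Hom C W (Dom C k) \<and> k \<cdot> u = k \<cdot> g"
    using k unfolding is_kernel_def by blast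
  then show "g = h" using g h e by metis
qed

end

section \<open>Exactness in abelian categories\<close>

context abelian_category
begin

text \<open>\<open>g\<close> is the cokernel of some \<open>a\<close>. Since \<open>a\<close>
  factors through the kernel \<open>m\<close>, an arrow that kills \<open>m\<close> also kills
  \<open>a\<close>.\<close>

lemma epi_cokernel_of_kernel:
  assumes g: "is_epi C g" and m: "is_kernel C g m" and h: "h \<in> Hom C (Dom C g) W"
    and hm: "h \<cdot> m = Zero C (Dom C m) W"
  obtains u where "u \<in> Hom C (Cod C g) W" "u \<cdot> g = h"
proof -
  obtain a where a: "is_cokernel C a g" using epi_is_cokernel[OF g] by blast
  note da = is_cokernelD[OF a] and dm = is_kernelD[OF m]
  obtain b where b: "b \<in> Hom C (Dom C a) (Dom C m)" "m \<cdot> b = a"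
    by (rule is_kernel_factor[OF m, of a "Dom C a"]) (use da in \<open>auto simp: Hom_iff\<close>)
  have "h \<cdot> a = (h \<cdot> m) \<cdot> b"
    using b h dm(1-3) by (auto simp: Hom_iff)
  also have "\<dots> = Zero C (Dom C a) W" using hm b h dm(1-3) by (auto simp: Hom_iff)
  finally show ?thesis
    using is_cokernel_factor[OF a, of h W] h da that by metis
qed

lemma is_cokernel_exact_at:
  assumes q: "is_cokernel C f q"
  shows "exact_at C f q"
  using q kernels_exist[OF is_cokernelD(2)[OF q]] unfolding exact_at_def by blast

text \<open>As an epimorphism, \<open>g\<close> is the cokernel of its kernel, which is the image of \<open>f\<close>.\<close>

lemma exact_at_is_cokernel:
  assumes ex: "exact_at C f g" and g: "is_epi C g"
  shows "is_cokernel C f g"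
proof -
  obtain q m where q: "is_cokernel C f q" and mq: "is_kernel C q m" and m: "is_kernel C g m"
    using ex unfolding exact_at_def by blast
  note dq = is_cokernelD[OF q] and dmq = is_kernelD[OF mq] and dm = is_kernelD[OF m]
  obtain b where b: "b \<in> Hom C (Dom C f) (Dom C m)" "m \<cdot> b = f"
    by (rule is_kernel_factor[OF mq, of f "Dom C f"]) (use dq in \<open>auto simp: Hom_iff\<close>)
  have "g \<cdot> f = (g \<cdot> m) \<cdot> b" using b dm(1-3) by (auto simp: Hom_iff)
  also have "\<dots> = Zero C (Dom C f) (Cod C g)" using b dm by (auto simp: Hom_iff)
  finally have gf: "g \<cdot> f = Zero C (Dom C f) (Cod C g)" .
  have D: "Dom C g = Cod C f" using dm dmq dq by simp
  show ?thesis
    unfolding is_cokernel_def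
  proof (intro conjI allI ballI impI)
    fix W h assume h: "h \<in> Hom C (Cod C f) W" and hf: "h \<cdot> f = Zero C (Dom C f) W"
    obtain v where v: "v \<in> Hom C (Cod C q) W" "v \<cdot> q = h"
      using is_cokernel_factor[OF q h hf] .
    have "h \<cdot> m = v \<cdot> (q \<cdot> m)" using v dmq(1-3) by (auto simp: Hom_iff)
    also have "\<dots> = Zero C (Dom C m) W" using v dmq by (auto simp: Hom_iff)
    finally obtain u where u: "u \<in> Hom C (Cod C g) W" "u \<cdot> g = h"
      using epi_cokernel_of_kernel[OF g m, of h W] h D by auto
    show "\<exists>!u. u \<in> Hom C (Cod C g) W \<and> u \<cdot> g = h"
    proof (rule ex1I[of _ u])
      fix u' assume "u' \<in> Hom C (Cod C g) W \<and> u' \<cdot> g = h"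
      then show "u' = u" using is_epiD[OF g, of u' u] u by (auto simp: Hom_iff)
    qed (use u in auto)
  qed (use dm dq D gf in auto)
qed

text \<open>\<open>right_exact\<close> only speaks of exact pairs, so an isolated epimorphism needs
  a partner before the hypothesis says anything about it.\<close>

lemma epi_exact_at:
  assumes e: "is_epi C e"
  obtains a where "exact_at C a e"
  using epi_is_cokernel[OF e] is_cokernel_exact_at by blast

lemma biproduct_spec:
  assumes "finite (J :: nat set)" "\<And>j. j \<in> J \<Longrightarrow> X j \<in> Ob C" "biproduct C J X = (B, \<iota>, \<pi>)"
  shows "is_biproduct C J X B \<iota> \<pi>"
proof -
  have "\<exists>t. case t of (B, \<iota>, \<pi>) \<Rightarrow> is_biproduct C J X B \<iota> \<pi>"
    using biproducts_exist[OF assms(1,2)] by fast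
  from someI_ex[OF this] show ?thesis
    using assms(3) unfolding biproduct_def by auto
qed

end


section \<open>The right \<open>n\<close>-trivial extension\<close>

locale n_trivial_extension = abelian_category C for C :: "('o, 'm) cat" (structure) +
  fixes n :: nat and F :: "nat \<Rightarrow> ('o, 'm, 'o, 'm) func" and \<Phi> :: "nat \<Rightarrow> nat \<Rightarrow> 'o \<Rightarrow> 'm"
  assumes F_additive: "i \<in> {1..n} \<Longrightarrow> additive_functor C C (F i)"
    and F_right_exact: "i \<in> {1..n} \<Longrightarrow> right_exact C C (F i)"
    and \<Phi>_nat_trans: "nat_trans_family C n F \<Phi>"
    and \<Phi>_assoc: "associative_family C n F \<Phi>"
begin

abbreviation "E \<equiv> trivial_extension C n F \<Phi>"
abbreviation "FO i \<equiv> FOb (F i)"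
abbreviation "FA i \<equiv> FAr (F i)"

lemma F_functor: "0 < i \<Longrightarrow> i \<le> n \<Longrightarrow> is_functor C C (F i)"
  using F_additive[of i] unfolding additive_functor_def by auto

lemma FO_Ob [simp]: "0 < i \<Longrightarrow> i \<le> n \<Longrightarrow> X \<in> Ob C \<Longrightarrow> FO i X \<in> Ob C"
  and FA_Ident [simp]: "0 < i \<Longrightarrow> i \<le> n \<Longrightarrow> X \<in> Ob C \<Longrightarrow> FA i (Ident C X) = Ident C (FO i X)"
  using F_functor[of i] by (simp_all add: is_functor_def)

lemma FA_Hom:
  assumes "0 < i" "i \<le> n" "u \<in> Hom C X Y"
  shows "FA i u \<in> Hom C (FO i X) (FO i Y)"
  using F_functor[OF assms(1,2)] assms(3) unfolding is_functor_def by blast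

lemma FA_typing [simp]:
  assumes "0 < i" "i \<le> n" "u \<in> Ar C"
  shows "FA i u \<in> Ar C" "Dom C (FA i u) = FO i (Dom C u)" "Cod C (FA i u) = FO i (Cod C u)"
  using FA_Hom[OF assms(1,2), of u "Dom C u" "Cod C u"] assms(3) by (auto simp: Hom_iff)

lemma FA_Comp [simp]:
  assumes "0 < i" "i \<le> n" "u \<in> Ar C" "v \<in> Ar C" "Dom C v = Cod C u"
  shows "FA i (v \<cdot> u) = FA i v \<cdot> FA i u"
proof -
  have "u \<in> Hom C (Dom C u) (Cod C u)" "v \<in> Hom C (Cod C u) (Cod C v)"
    using assms by (auto simp: Hom_iff)
  then show ?thesis
    using F_functor[OF assms(1,2)] unfolding is_functor_def by blast
qed

lemma FA_Zero [simp]: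
  "0 < i \<Longrightarrow> i \<le> n \<Longrightarrow> X \<in> Ob C \<Longrightarrow> Y \<in> Ob C \<Longrightarrow> FA i (Zero C X Y) = Zero C (FO i X) (FO i Y)"
  using additive_functor_Zero[OF F_additive[of i] preadditive_category_axioms] by auto

lemma FA_biproduct:
  assumes "0 < i" "i \<le> n" "finite J" "is_biproduct C J X B \<iota> \<pi>"
  shows "is_biproduct C J (\<lambda>j. FO i (X j)) (FO i B) (\<lambda>j. FA i (\<iota> j)) (\<lambda>j. FA i (\<pi> j))"
  using additive_functor_biproduct[OF F_additive[of i] preadditive_category_axioms assms(3,4)]
    assms(1,2) by simp

lemma FA_epi:
  assumes "0 < i" "i \<le> n" "is_epi C e"
  shows "is_epi C (FA i e)"
  using epi_exact_at[OF assms(3)] F_right_exact[of i] assms unfolding right_exact_def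
  by (metis One_nat_def Suc_leI atLeastAtMost_iff)

text \<open>A pair that is exact with an epimorphism on the right is the same as an arrow with its
  cokernel, so right exactness can be read as preservation of cokernels.\<close>

lemma FA_cokernel:
  assumes i: "0 < i" "i \<le> n" and q: "is_cokernel C e q"
  shows "is_cokernel C (FA i e) (FA i q)"
proof (rule exact_at_is_cokernel)
  show "exact_at C (FA i e) (FA i q)"
    using F_right_exact[of i] i is_cokernel_exact_at[OF q] is_cokernel_epi[OF q]
    unfolding right_exact_def by simp
  show "is_epi C (FA i q)" using i is_cokernel_epi[OF q] by (rule FA_epi)
qed

lemma \<Phi>_nat:
  assumes "0 < i" "0 < j" "i + j \<le> n"
  shows "is_nat_trans C C (func_comp (F i) (F j)) (F (i + j)) (\<Phi> i j)"
  using \<Phi>_nat_trans assms unfolding nat_trans_family_def by simp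

lemma \<Phi>_typing [simp]:
  assumes "0 < i" "0 < j" "i + j \<le> n" "X \<in> Ob C"
  shows "\<Phi> i j X \<in> Ar C" "Dom C (\<Phi> i j X) = FO i (FO j X)" "Cod C (\<Phi> i j X) = FO (i + j) X"
  using \<Phi>_nat[OF assms(1-3)] assms(4) unfolding is_nat_trans_def
  by (auto simp: func_comp_def Hom_iff)

lemma \<Phi>_natural:
  assumes "0 < i" "0 < j" "i + j \<le> n" "u \<in> Hom C X Y"
  shows "\<Phi> i j Y \<cdot> FA i (FA j u) = FA (i + j) u \<cdot> \<Phi> i j X"
proof -
  have "\<Phi> i j Y \<cdot> FAr (func_comp (F i) (F j)) u = FA (i + j) u \<cdot> \<Phi> i j X"
    using \<Phi>_nat[OF assms(1-3)] assms(4) unfolding is_nat_trans_def by blast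
  then show ?thesis by (simp add: func_comp_def)
qed

lemma \<Phi>_associative:
  assumes "0 < i" "0 < j" "0 < k" "i + j + k \<le> n" "X \<in> Ob C"
  shows "\<Phi> i (j + k) X \<cdot> FA i (\<Phi> j k X) = \<Phi> (i + j) k X \<cdot> \<Phi> i j (FO k X)"
  using \<Phi>_assoc assms unfolding associative_family_def by simp

section \<open>Objects and arrows of the extension\<close>

lemma E_objectI:
  assumes "X \<in> Ob C" "\<alpha> \<in> extensional {1..n}"
    and "\<And>i. 0 < i \<Longrightarrow> i \<le> n \<Longrightarrow> \<alpha> i \<in> Hom C (FO i X) X"
    and "\<And>i j. 0 < i \<Longrightarrow> i \<le> n \<Longrightarrow> 0 < j \<Longrightarrow> j \<le> n \<Longrightarrow> i + j \<le> n \<Longrightarrow>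
      \<alpha> i \<cdot> FA i (\<alpha> j) = \<alpha> (i + j) \<cdot> \<Phi> i j X"
    and "\<And>i j. 0 < i \<Longrightarrow> i \<le> n \<Longrightarrow> 0 < j \<Longrightarrow> j \<le> n \<Longrightarrow> \<not> i + j \<le> n \<Longrightarrow>
      \<alpha> i \<cdot> FA i (\<alpha> j) = Zero C (FO i (FO j X)) X"
  shows "(X, \<alpha>) \<in> Ob E"
  using assms by (auto simp: trivial_extension_def ext_objects_def PiE_def)

lemma E_objectD:
  assumes "(X, \<alpha>) \<in> Ob E"
  shows "X \<in> Ob C"
    and "\<And>i. 0 < i \<Longrightarrow> i \<le> n \<Longrightarrow> \<alpha> i \<in> Ar C"
    and "\<And>i. 0 < i \<Longrightarrow> i \<le> n \<Longrightarrow> Dom C (\<alpha> i) = FO i X"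
    and "\<And>i. 0 < i \<Longrightarrow> i \<le> n \<Longrightarrow> Cod C (\<alpha> i) = X"
    and "\<And>i j. 0 < i \<Longrightarrow> i \<le> n \<Longrightarrow> 0 < j \<Longrightarrow> j \<le> n \<Longrightarrow> i + j \<le> n \<Longrightarrow>
      \<alpha> i \<cdot> FA i (\<alpha> j) = \<alpha> (i + j) \<cdot> \<Phi> i j X"
    and "\<And>i j. 0 < i \<Longrightarrow> i \<le> n \<Longrightarrow> 0 < j \<Longrightarrow> j \<le> n \<Longrightarrow> \<not> i + j \<le> n \<Longrightarrow>
      \<alpha> i \<cdot> FA i (\<alpha> j) = Zero C (FO i (FO j X)) X"
  using assms by (auto simp: trivial_extension_def ext_objects_def PiE_def Pi_def Hom_iff)

text \<open>Arrows of the extension are triples; this is the condition on the third component alone,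
  which allows computing with arrows of \<open>C\<close> throughout.\<close>

definition E_map :: "'o \<times> (nat \<Rightarrow> 'm) \<Rightarrow> 'o \<times> (nat \<Rightarrow> 'm) \<Rightarrow> 'm \<Rightarrow> bool" where
  "E_map S T \<gamma> \<longleftrightarrow> S \<in> Ob E \<and> T \<in> Ob E \<and> \<gamma> \<in> Hom C (fst S) (fst T) \<and>
    (\<forall>i \<in> {1..n}. \<gamma> \<cdot> snd S i = snd T i \<cdot> FA i \<gamma>)"

lemma E_mapI:
  assumes "(X, \<alpha>) \<in> Ob E" "(Y, \<beta>) \<in> Ob E" "\<gamma> \<in> Hom C X Y"
    and "\<And>i. 0 < i \<Longrightarrow> i \<le> n \<Longrightarrow> \<gamma> \<cdot> \<alpha> i = \<beta> i \<cdot> FA i \<gamma>"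
  shows "E_map (X, \<alpha>) (Y, \<beta>) \<gamma>"
  using assms by (simp add: E_map_def)

lemma E_mapD:
  assumes "E_map (X, \<alpha>) (Y, \<beta>) \<gamma>"
  shows "(X, \<alpha>) \<in> Ob E" "(Y, \<beta>) \<in> Ob E" "\<gamma> \<in> Ar C" "Dom C \<gamma> = X" "Cod C \<gamma> = Y"
    and "\<And>i. 0 < i \<Longrightarrow> i \<le> n \<Longrightarrow> \<gamma> \<cdot> \<alpha> i = \<beta> i \<cdot> FA i \<gamma>"
  using assms by (auto simp: E_map_def Hom_iff)

lemma E_Hom_iff: "u \<in> Hom E S T \<longleftrightarrow> (\<exists>\<gamma>. u = (S, T, \<gamma>) \<and> E_map S T \<gamma>)"
  by (cases S; cases T; cases u) (auto simp: trivial_extension_def Hom_def E_map_def)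

lemma E_simps [simp]:
  "Dom E (S, T, \<gamma>) = S" "Cod E (S, T, \<gamma>) = T"
  "Comp E (S', T', \<delta>) (S, T, \<gamma>) = (S, T', \<delta> \<cdot> \<gamma>)"
  "Add E (S, T, \<gamma>) (S', T', \<delta>) = (S, T, Add C \<gamma> \<delta>)"
  by (simp_all add: trivial_extension_def)

lemma E_Ident: "Ident E S = (S, S, Ident C (fst S))"
  by (cases S) (simp add: trivial_extension_def)

lemma E_Zero: "Zero E S T = (S, T, Zero C (fst S) (fst T))"
  by (cases S; cases T) (simp add: trivial_extension_def)

lemma E_Ar_iff: "(S, T, \<gamma>) \<in> Ar E \<longleftrightarrow> E_map S T \<gamma>"
  using E_Hom_iff[of "(S, T, \<gamma>)" S T] by (simp add: Hom_def)

lemma E_map_Comp: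
  assumes \<gamma>: "E_map S T \<gamma>" and \<delta>: "E_map T U \<delta>"
  shows "E_map S U (\<delta> \<cdot> \<gamma>)"
proof -
  obtain X \<alpha> Y \<beta> Z \<zeta> where e: "S = (X, \<alpha>)" "T = (Y, \<beta>)" "U = (Z, \<zeta>)"
    by (cases S; cases T; cases U)
  note g = E_mapD[OF \<gamma>[unfolded e]] and d = E_mapD[OF \<delta>[unfolded e]]
  note X = E_objectD[OF g(1)] and Y = E_objectD[OF g(2)] and Z = E_objectD[OF d(2)]
  show ?thesis unfolding e
  proof (rule E_mapI)
    fix i assume i: "0 < i" "i \<le> n"
    have "(\<delta> \<cdot> \<gamma>) \<cdot> \<alpha> i = \<delta> \<cdot> (\<beta> i \<cdot> FA i \<gamma>)"
      using i g d(3-5) X(2-4) by simp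
    also have "\<dots> = (\<delta> \<cdot> \<beta> i) \<cdot> FA i \<gamma>"
      using i g(1-5) d(3-5) Y(2-4) by simp
    also have "\<dots> = \<zeta> i \<cdot> FA i (\<delta> \<cdot> \<gamma>)"
      using i g(1-5) d(3-6) Y(2-4) Z(2-4) by simp
    finally show "(\<delta> \<cdot> \<gamma>) \<cdot> \<alpha> i = \<zeta> i \<cdot> FA i (\<delta> \<cdot> \<gamma>)" .
  qed (use g d in \<open>auto simp: Hom_iff\<close>)
qed

lemma E_map_Ident:
  assumes "S \<in> Ob E"
  shows "E_map S S (Ident C (fst S))"
proof -
  obtain X \<alpha> where e: "S = (X, \<alpha>)" by (cases S)
  note X = E_objectD[OF assms[unfolded e]]
  show ?thesis unfolding e fst_conv
    by (rule E_mapI) (use X assms e in \<open>auto simp: Hom_iff\<close>)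
qed

lemma category_E: "category E"
proof
  show "Dom E u \<in> Ob E" "Cod E u \<in> Ob E" if "u \<in> Ar E" for u
    using that by (cases u; auto simp: E_Ar_iff E_map_def)+
  show "Ident E S \<in> Hom E S S" if "S \<in> Ob E" for S
    using E_map_Ident[OF that] by (simp add: E_Ident E_Hom_iff)
  show "Comp E v u \<in> Hom E S U" if "u \<in> Hom E S T" "v \<in> Hom E T U" for u v S T U
    using that by (auto simp: E_Hom_iff intro: E_map_Comp)
  show "Comp E (Comp E w v) u = Comp E w (Comp E v u)"
    if "u \<in> Hom E S T" "v \<in> Hom E T U" "w \<in> Hom E U V" for u v w S T U V
    using that by (auto simp: E_Hom_iff E_map_def Hom_iff)
  show "Comp E u (Ident E S) = u" "Comp E (Ident E T) u = u" if "u \<in> Hom E S T" for u S T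
    using that by (auto simp: E_Hom_iff E_Ident E_map_def Hom_iff)
qed

section \<open>Addition of arrows in the extension\<close>

lemma E_map_Zero:
  assumes "S \<in> Ob E" "T \<in> Ob E"
  shows "E_map S T (Zero C (fst S) (fst T))"
proof -
  obtain X \<alpha> Y \<beta> where e: "S = (X, \<alpha>)" "T = (Y, \<beta>)" by (cases S; cases T)
  note X = E_objectD[OF assms(1)[unfolded e]] and Y = E_objectD[OF assms(2)[unfolded e]]
  show ?thesis unfolding e fst_conv
    by (rule E_mapI) (use X Y assms e in \<open>auto simp: Hom_iff\<close>)
qed

lemma FA_Add:
  assumes "0 < i" "i \<le> n" "u \<in> Hom C X Y" "v \<in> Hom C X Y"
  shows "FA i (Add C u v) = Add C (FA i u) (FA i v)"
  using F_additive[of i] assms unfolding additive_functor_def by auto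

lemma E_map_Add:
  assumes \<gamma>: "E_map S T \<gamma>" and \<delta>: "E_map S T \<delta>"
  shows "E_map S T (Add C \<gamma> \<delta>)"
proof -
  obtain X \<alpha> Y \<beta> where e: "S = (X, \<alpha>)" "T = (Y, \<beta>)" by (cases S; cases T)
  note g = E_mapD[OF \<gamma>[unfolded e]] and d = E_mapD[OF \<delta>[unfolded e]]
  note X = E_objectD[OF g(1)] and Y = E_objectD[OF g(2)]
  show ?thesis unfolding e
  proof (rule E_mapI)
    fix i assume i: "0 < i" "i \<le> n"
    have "Add C \<gamma> \<delta> \<cdot> \<alpha> i = Add C (\<beta> i \<cdot> FA i \<gamma>) (\<beta> i \<cdot> FA i \<delta>)"
      using i g d X(2-4) by (simp add: Comp_Add_left')
    also have "\<dots> = \<beta> i \<cdot> FA i (Add C \<gamma> \<delta>)"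
      using i g d Y(2-4) by (simp add: FA_Add[of i _ X Y] Hom_iff Comp_Add_right')
    finally show "Add C \<gamma> \<delta> \<cdot> \<alpha> i = \<beta> i \<cdot> FA i (Add C \<gamma> \<delta>)" .
  qed (use g d in \<open>auto simp: Hom_iff\<close>)
qed

text \<open>\<open>hom_sum\<close> is a \<open>finprod\<close>, whose rules require a commutative
  monoid. This serves to evaluate the two-term sum in the definition of a direct summand of the
  extension.\<close>

lemma E_hom_monoid:
  assumes "S \<in> Ob E" "T \<in> Ob E"
  shows "comm_monoid (hom_group E S T)"
proof -
  have H: "\<gamma> \<in> Hom C (fst S) (fst T)" if "E_map S T \<gamma>" for \<gamma>
    using that by (simp add: E_map_def)
  show ?thesis
  proof (rule comm_monoidI)
    fix u v assume "u \<in> carrier (hom_group E S T)" "v \<in> carrier (hom_group E S T)"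
    then show "u \<otimes>\<^bsub>hom_group E S T\<^esub> v \<in> carrier (hom_group E S T)"
      "u \<otimes>\<^bsub>hom_group E S T\<^esub> v = v \<otimes>\<^bsub>hom_group E S T\<^esub> u"
      using Add_commute[OF H H] by (auto simp: hom_group_def E_Hom_iff intro: E_map_Add)
  next
    fix u v w assume "u \<in> carrier (hom_group E S T)" "v \<in> carrier (hom_group E S T)"
      "w \<in> carrier (hom_group E S T)"
    then show "u \<otimes>\<^bsub>hom_group E S T\<^esub> v \<otimes>\<^bsub>hom_group E S T\<^esub> w
        = u \<otimes>\<^bsub>hom_group E S T\<^esub> (v \<otimes>\<^bsub>hom_group E S T\<^esub> w)"
      using Add_assoc[OF H H H] by (auto simp: hom_group_def E_Hom_iff)
  next
    show "\<one>\<^bsub>hom_group E S T\<^esub> \<in> carrier (hom_group E S T)"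
      using E_map_Zero[OF assms] by (auto simp: hom_group_def E_Hom_iff E_Zero)
  next
    fix u assume "u \<in> carrier (hom_group E S T)"
    then show "\<one>\<^bsub>hom_group E S T\<^esub> \<otimes>\<^bsub>hom_group E S T\<^esub> u = u"
      using H by (auto simp: hom_group_def E_Hom_iff E_Zero Hom_iff)
  qed
qed

text \<open>The forgetful functor is faithful, so it reflects epimorphisms.\<close>

lemma E_epiI:
  assumes g: "E_map S T \<gamma>" and e: "is_epi C \<gamma>"
  shows "is_epi E (S, T, \<gamma>)"
  unfolding is_epi_def
proof (intro conjI allI ballI impI)
  show "(S, T, \<gamma>) \<in> Ar E" using g by (simp add: E_Ar_iff)
  fix U u v assume u: "u \<in> Hom E (Cod E (S, T, \<gamma>)) U" and v: "v \<in> Hom E (Cod E (S, T, \<gamma>)) U"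
    and eq: "Comp E u (S, T, \<gamma>) = Comp E v (S, T, \<gamma>)"
  obtain a b where ab: "u = (T, U, a)" "v = (T, U, b)" "E_map T U a" "E_map T U b"
    using u v by (auto simp: E_Hom_iff)
  have "a = b"
    by (rule is_epiD[OF e]) (use eq ab g in \<open>auto simp: E_map_def Hom_iff\<close>)
  then show "u = v" using ab by simp
qed

text \<open>
  The cokernel in \<open>C\<close> of the underlying arrow carries a structure, because the \<open>F i\<close> preserve
  cokernels; hence it vanishes if the arrow is an epimorphism of the extension.
\<close>

lemma E_epiD:
  assumes e: "is_epi E (S, T, \<gamma>)"
  shows "is_epi C \<gamma>"
proof -
  have \<gamma>: "E_map S T \<gamma>" using e by (simp add: is_epi_def E_Ar_iff)
  obtain X \<alpha> Y \<beta> where st: "S = (X, \<alpha>)" "T = (Y, \<beta>)" by (cases S; cases T)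
  note g = E_mapD[OF \<gamma>[unfolded st]]
  note X = E_objectD[OF g(1)] and Y = E_objectD[OF g(2)]
  obtain q where q: "is_cokernel C \<gamma> q" using cokernels_exist[OF g(3)] by blast
  note dq = is_cokernelD[OF q]
  define W where "W = Cod C q"
  have W: "W \<in> Ob C" using dq by (simp add: W_def)
  \<comment> \<open>\<open>q \<cdot> \<beta> i\<close> kills \<open>FA i \<gamma>\<close>, because
    \<gamma> commutes with the structures and \<open>q \<cdot> \<gamma>\<close> is zero; and
    \<open>FA i q\<close> is the cokernel of \<open>FA i \<gamma>\<close>.\<close>
  have "\<exists>w. w \<in> Hom C (FO i W) W \<and> w \<cdot> FA i q = q \<cdot> \<beta> i" if i: "0 < i" "i \<le> n" for i
  proof -
    have "(q \<cdot> \<beta> i) \<cdot> FA i \<gamma> = q \<cdot> (\<gamma> \<cdot> \<alpha> i)"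
      using i g dq(1-3) Y(2-4) X(2-4) by simp
    also have "\<dots> = (q \<cdot> \<gamma>) \<cdot> \<alpha> i" using i g(1-5) dq(1-3) Y(2-4) X(2-4) by simp
    also have "\<dots> = Zero C (FO i X) W" using i g dq W X(2-4) by (simp add: W_def)
    finally have z: "(q \<cdot> \<beta> i) \<cdot> FA i \<gamma> = Zero C (Dom C (FA i \<gamma>)) W" using i g by simp
    have h: "q \<cdot> \<beta> i \<in> Hom C (Cod C (FA i \<gamma>)) W"
      using i g(3-5) dq(1-3) Y(2-4) by (simp add: Hom_iff W_def)
    obtain w where "w \<in> Hom C (Cod C (FA i q)) W" "w \<cdot> FA i q = q \<cdot> \<beta> i"
      using is_cokernel_factor[OF FA_cokernel[OF i q] h z] .
    then show ?thesis using i dq by (auto simp: W_def)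
  qed
  then obtain w' where w': "\<And>i. 0 < i \<Longrightarrow> i \<le> n \<Longrightarrow> w' i \<in> Hom C (FO i W) W \<and> w' i \<cdot> FA i q = q \<cdot> \<beta> i"
    by metis
  \<comment> \<open>Structure families must be \<open>undefined\<close> outside
    \<open>{1..n}\<close>.\<close>
  define w where "w = restrict w' {1..n}"
  have w: "w i \<in> Ar C" "Dom C (w i) = FO i W" "Cod C (w i) = W" "w i \<cdot> FA i q = q \<cdot> \<beta> i"
    if "0 < i" "i \<le> n" for i
    using w'[OF that] that by (auto simp: w_def Hom_iff)
  have qq: "q \<in> Ar C" "Dom C q = Y" "Cod C q = W" "is_epi C q"
    using dq g is_cokernel_epi[OF q] by (auto simp: W_def)
  \<comment> \<open>The structure equations for \<open>w\<close> are tested on the epimorphism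
    \<open>FA i (FA j q)\<close>, where they turn into those for \<beta> followed by
    \<open>q\<close>.\<close>
  have key: "(w i \<cdot> FA i (w j)) \<cdot> FA i (FA j q) = q \<cdot> (\<beta> i \<cdot> FA i (\<beta> j))"
    if i: "0 < i" "i \<le> n" and j: "0 < j" "j \<le> n" for i j
  proof -
    have "(w i \<cdot> FA i (w j)) \<cdot> FA i (FA j q) = w i \<cdot> FA i (w j \<cdot> FA j q)"
      using i j w(1-3) qq by simp
    also have "\<dots> = (w i \<cdot> FA i q) \<cdot> FA i (\<beta> j)"
      using i j w(1-3) w(4)[OF j] qq Y(2-4) by simp
    also have "\<dots> = q \<cdot> (\<beta> i \<cdot> FA i (\<beta> j))"
      unfolding w(4)[OF i] using i j qq Y(2-4) by simp
    finally show ?thesis .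
  qed
  have WE: "(W, w) \<in> Ob E"
  proof (rule E_objectI)
    fix i j assume i: "0 < i" "i \<le> n" and j: "0 < j" "j \<le> n"
    have ep: "is_epi C (FA i (FA j q))" using i j qq(4) by (intro FA_epi)
    { assume ij: "i + j \<le> n"
      have "(w i \<cdot> FA i (w j)) \<cdot> FA i (FA j q) = q \<cdot> (\<beta> (i + j) \<cdot> \<Phi> i j Y)"
        using key[OF i j] Y(5)[OF i j ij] by simp
      also have "\<dots> = (w (i + j) \<cdot> FA (i + j) q) \<cdot> \<Phi> i j Y"
        using i j ij w(4)[of "i + j"] w(1-3) qq Y(1-4) by simp
      also have "\<dots> = (w (i + j) \<cdot> \<Phi> i j W) \<cdot> FA i (FA j q)"
        using i j ij w(1-3) qq Y(1-4) W \<Phi>_natural[of i j q Y W] by (simp add: Hom_iff)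
      finally show "w i \<cdot> FA i (w j) = w (i + j) \<cdot> \<Phi> i j W"
        by (rule is_epiD[OF ep]) (use i j ij w(1-3) qq W in auto) }
    { assume ij: "\<not> i + j \<le> n"
      have "(w i \<cdot> FA i (w j)) \<cdot> FA i (FA j q) = Zero C (FO i (FO j W)) W \<cdot> FA i (FA j q)"
        using key[OF i j] Y(1) Y(6)[OF i j ij] qq W i j by simp
      then show "w i \<cdot> FA i (w j) = Zero C (FO i (FO j W)) W"
        by (rule is_epiD[OF ep]) (use i j ij w(1-3) qq W in auto) }
  qed (use W w in \<open>auto simp: w_def Hom_iff\<close>)
  have qE: "E_map T (W, w) q"
    unfolding st by (rule E_mapI) (use g WE qq w in \<open>auto simp: Hom_iff\<close>)
  have zE: "E_map T (W, w) (Zero C Y W)"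
    using E_map_Zero[of T "(W, w)"] g(2) WE st by simp
  \<comment> \<open>Both arrows give zero after \<gamma>, and now that \<open>W\<close> carries a
    structure both belong to the extension, where \<gamma> can be cancelled.\<close>
  have "(T, (W, w), q) = (T, (W, w), Zero C Y W)"
    by (rule category.is_epiD[OF category_E e])
      (use qE zE g dq W in \<open>auto simp: E_Ar_iff W_def\<close>)
  then have q0: "q = Zero C Y W" by simp
  show "is_epi C \<gamma>"
  proof (rule is_epiI_Zero[OF g(3)])
    fix h assume h: "h \<in> Ar C" "Dom C h = Cod C \<gamma>" "h \<cdot> \<gamma> = Zero C (Dom C \<gamma>) (Cod C h)"
    obtain u where "u \<in> Hom C (Cod C q) (Cod C h)" "u \<cdot> q = h"
      by (rule is_cokernel_factor[OF q, of h "Cod C h"]) (use h in \<open>auto simp: Hom_iff\<close>)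
    then show "h = Zero C (Cod C \<gamma>) (Cod C h)"
      using q0 W Y(1) h g qq by (auto simp: Hom_iff)
  qed
qed

text \<open>
  \<open>q\<close> is the cokernel of the row \<open>(\<beta>\<^sub>i)\<^sub>i\<close> and remains so under each \<open>F i\<close>; no direct sum
  of the \<open>F i Y\<close> has to be chosen.
\<close>

definition row_cokernel :: "'o \<Rightarrow> (nat \<Rightarrow> 'm) \<Rightarrow> 'm \<Rightarrow> bool" where
  "row_cokernel Y \<beta> q \<longleftrightarrow> q \<in> Ar C \<and> Dom C q = Y \<and> is_epi C q \<and>
    (\<forall>i. 0 < i \<longrightarrow> i \<le> n \<longrightarrow> q \<cdot> \<beta> i = Zero C (FO i Y) (Cod C q)) \<and>
    (\<forall>W. \<forall>h \<in> Hom C Y W. (\<forall>j. 0 < j \<longrightarrow> j \<le> n \<longrightarrow> h \<cdot> \<beta> j = Zero C (FO j Y) W) \<longrightarrow>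
      (\<exists>u \<in> Hom C (Cod C q) W. u \<cdot> q = h)) \<and>
    (\<forall>i. 0 < i \<longrightarrow> i \<le> n \<longrightarrow> (\<forall>W. \<forall>h \<in> Hom C (FO i Y) W.
      (\<forall>j. 0 < j \<longrightarrow> j \<le> n \<longrightarrow> h \<cdot> FA i (\<beta> j) = Zero C (FO i (FO j Y)) W) \<longrightarrow>
      (\<exists>u \<in> Hom C (FO i (Cod C q)) W. u \<cdot> FA i q = h)))"

lemma row_cokernelD:
  assumes "row_cokernel Y \<beta> q"
  shows "q \<in> Ar C" "Dom C q = Y" "is_epi C q"
    and "\<And>i. 0 < i \<Longrightarrow> i \<le> n \<Longrightarrow> q \<cdot> \<beta> i = Zero C (FO i Y) (Cod C q)"
  using assms unfolding row_cokernel_def by auto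

lemma row_cokernel_factor:
  assumes "row_cokernel Y \<beta> q" "h \<in> Hom C Y W"
    and "\<And>j. 0 < j \<Longrightarrow> j \<le> n \<Longrightarrow> h \<cdot> \<beta> j = Zero C (FO j Y) W"
  obtains u where "u \<in> Hom C (Cod C q) W" "u \<cdot> q = h"
  using assms unfolding row_cokernel_def by blast

lemma row_cokernel_FA_factor:
  assumes "row_cokernel Y \<beta> q" "0 < i" "i \<le> n" "h \<in> Hom C (FO i Y) W"
    and "\<And>j. 0 < j \<Longrightarrow> j \<le> n \<Longrightarrow> h \<cdot> FA i (\<beta> j) = Zero C (FO i (FO j Y)) W"
  obtains u where "u \<in> Hom C (FO i (Cod C q)) W" "u \<cdot> FA i q = h"
  using assms unfolding row_cokernel_def by blast

text \<open>
  A form of Nakayama's lemma: the row \<open>\<beta>\<close> is nilpotent, as \<open>\<beta>\<^sub>i F\<^sub>i(\<beta>\<^sub>j)\<close> is \<open>0\<close> or factors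
  through \<open>\<beta>\<^sub>i\<^sub>+\<^sub>j\<close>. This allows descending induction on \<open>i\<close>.
\<close>

lemma epi_if_row_cokernel_Comp_epi:
  assumes \<gamma>: "E_map (X, \<alpha>) (Y, \<beta>) \<gamma>" and q: "row_cokernel Y \<beta> q" and q\<gamma>: "is_epi C (q \<cdot> \<gamma>)"
  shows "is_epi C \<gamma>"
proof -
  note g = E_mapD[OF \<gamma>]
  note X = E_objectD[OF g(1)] and Y = E_objectD[OF g(2)]
  note dq = row_cokernelD[OF q]
  show ?thesis
  proof (rule is_epiI_Zero[OF g(3)])
    fix c assume c: "c \<in> Ar C" "Dom C c = Cod C \<gamma>" "c \<cdot> \<gamma> = Zero C (Dom C \<gamma>) (Cod C c)"
    define W where "W = Cod C c"
    have W: "W \<in> Ob C" using c by (simp add: W_def)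
    \<comment> \<open>The aim is that \<open>c\<close> kills the whole row and so factors through
      \<open>q\<close>. The measure \<open>n - i\<close> decreases from \<open>i\<close> to
      \<open>i + j\<close>, and for \<open>i + j\<close> beyond \<open>n\<close> the composite is
      already zero.\<close>
    have c\<beta>: "c \<cdot> \<beta> i = Zero C (FO i Y) W" if "0 < i" "i \<le> n" for i
      using that
    proof (induction i rule: measure_induct_rule[of "\<lambda>i. n - i"])
      case (less i)
      note i = less.prems
      have h: "c \<cdot> \<beta> i \<in> Hom C (FO i Y) W"
        using c g i Y(1-4) by (simp add: Hom_iff W_def)
      have "(c \<cdot> \<beta> i) \<cdot> FA i (\<beta> j) = Zero C (FO i (FO j Y)) W" if j: "0 < j" "j \<le> n" for j
      proof -
        have *: "(c \<cdot> \<beta> i) \<cdot> FA i (\<beta> j) = c \<cdot> (\<beta> i \<cdot> FA i (\<beta> j))"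
          using c g i j Y(1-4) by simp
        show ?thesis
        proof (cases "i + j \<le> n")
          case True
          have z: "c \<cdot> \<beta> (i + j) = Zero C (FO (i + j) Y) W"
            using less.IH[of "i + j"] True i j by auto
          have "c \<cdot> (\<beta> i \<cdot> FA i (\<beta> j)) = (c \<cdot> \<beta> (i + j)) \<cdot> \<Phi> i j Y"
            using c g i j True Y(1-4) Y(5)[OF i j True] by simp
          also have "\<dots> = Zero C (FO i (FO j Y)) W"
            unfolding z using i j True W Y(1) by simp
          finally show ?thesis using * by simp
        next
          case False
          then show ?thesis using * Y(6)[OF i j False] Y(1) c g i j by (simp add: W_def)
        qed
      qed
      then obtain d where d: "d \<in> Hom C (FO i (Cod C q)) W" "d \<cdot> FA i q = c \<cdot> \<beta> i"
        using row_cokernel_FA_factor[OF q i h] by blast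
      \<comment> \<open>\<open>d\<close> is tested on the epimorphism
        \<open>FA i (q \<cdot> \<gamma>)\<close>: there it becomes
        \<open>c \<cdot> \<gamma> \<cdot> \<alpha> i\<close>, which vanishes by the choice of
        \<open>c\<close>.\<close>
      have "d \<cdot> FA i (q \<cdot> \<gamma>) = (d \<cdot> FA i q) \<cdot> FA i \<gamma>"
        using i d(1) dq(1,2) g(1-5) by (simp add: Hom_iff)
      also have "\<dots> = c \<cdot> (\<gamma> \<cdot> \<alpha> i)"
        using i d(2) c(1,2) g Y(1-4) by simp
      also have "\<dots> = (c \<cdot> \<gamma>) \<cdot> \<alpha> i"
        using i c(1,2) g(1-5) X(1-4) by simp
      also have "\<dots> = Zero C (FO i X) W"
        using i c g(1-5) X(1-4) W by (simp add: W_def)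
      finally have "d \<cdot> FA i (q \<cdot> \<gamma>) = Zero C (FO i X) W" .
      then have "d = Zero C (FO i (Cod C q)) W"
        using is_epi_Zero[OF FA_epi[OF i q\<gamma>], of d] i d(1) dq(1,2) g(1-5) by (simp add: Hom_iff)
      then show "c \<cdot> \<beta> i = Zero C (FO i Y) W"
        using d(2) dq(1,2) i W by simp
    qed
    obtain u where u: "u \<in> Hom C (Cod C q) W" "u \<cdot> q = c"
      using row_cokernel_factor[OF q, of c W] c c\<beta> g by (auto simp: Hom_iff W_def)
    have "u \<cdot> (q \<cdot> \<gamma>) = c \<cdot> \<gamma>"
      using u dq(1,2) g(1-5) by (auto simp: Hom_iff)
    then have "u = Zero C (Cod C q) W"
      using is_epi_Zero[OF q\<gamma>, of u] u(1) c g dq(1,2) by (simp add: Hom_iff W_def)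
    then show "c = Zero C (Cod C \<gamma>) (Cod C c)"
      using u dq(1,2) W c(2) g(5) by (auto simp: W_def)
  qed
qed

text \<open>The direct sum \<open>S\<close> chosen in \<open>C_ob\<close> is confined to this proof.
  As \<open>F i\<close> preserves both the biproduct and the cokernel, vanishing on
  \<open>FA i r\<close> can be checked on the single entries
  \<open>FA i (\<alpha> j)\<close>.\<close>

lemma C_ob_row_cokernel:
  assumes XE: "(X, \<alpha>) \<in> Ob E"
  obtains q where "row_cokernel X \<alpha> q" "Cod C q = C_ob C n F (X, \<alpha>)"
proof -
  note X = E_objectD[OF XE]
  obtain S \<iota> \<pi> where S: "biproduct C {1..n} (\<lambda>i. FO i X) = (S, \<iota>, \<pi>)" by (metis prod_cases3)
  have B: "is_biproduct C {1..n} (\<lambda>i. FO i X) S \<iota> \<pi>"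
    by (rule biproduct_spec[OF _ _ S]) (use X in auto)
  have SO: "S \<in> Ob C" using B unfolding is_biproduct_def by blast
  have bH: "\<iota> i \<in> Ar C" "Dom C (\<iota> i) = FO i X" "Cod C (\<iota> i) = S" if "0 < i" "i \<le> n" for i
    using biproduct_Hom(2)[OF B, of i] that by (auto simp: Hom_iff)
  define r where "r = hom_sum C S X (\<lambda>i. \<alpha> i \<cdot> \<pi> i) {1..n}"
  have r: "r \<in> Hom C S X" "\<And>i. i \<in> {1..n} \<Longrightarrow> r \<cdot> \<iota> i = \<alpha> i"
    unfolding r_def by (rule biproduct_copair[OF B]; use X in \<open>auto simp: Hom_iff\<close>)+
  define q where "q = (SOME q. is_cokernel C r q)"
  have q: "is_cokernel C r q"
    unfolding q_def by (rule someI_ex, rule cokernels_exist) (use r in \<open>auto simp: Hom_iff\<close>)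
  note dq = is_cokernelD[OF q]
  have rT: "r \<in> Ar C" "Dom C r = S" "Cod C r = X" using r(1) by (auto simp: Hom_iff)
  have qT: "q \<in> Ar C" "Dom C q = X" using dq rT by auto
  have "row_cokernel X \<alpha> q"
    unfolding row_cokernel_def
  proof (intro conjI allI impI ballI)
    show "is_epi C q" using q by (rule is_cokernel_epi)
    fix i assume i: "0 < i" "i \<le> n"
    have "q \<cdot> \<alpha> i = (q \<cdot> r) \<cdot> \<iota> i" using i bH qT rT r(2)[of i] by simp
    then show "q \<cdot> \<alpha> i = Zero C (FO i X) (Cod C q)"
      using i bH dq rT by simp
  next
    fix W h assume h: "h \<in> Hom C X W" "\<forall>j>0. j \<le> n \<longrightarrow> h \<cdot> \<alpha> j = Zero C (FO j X) W"
    have W: "W \<in> Ob C" using h Hom_Ob by blast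
    have "h \<cdot> r = Zero C S W"
    proof (rule biproduct_ext[OF B])
      fix j assume j: "j \<in> {1..n}"
      then have "(h \<cdot> r) \<cdot> \<iota> j = h \<cdot> \<alpha> j" using bH[of j] rT r(2)[of j] h(1) by (auto simp: Hom_iff)
      then show "(h \<cdot> r) \<cdot> \<iota> j = Zero C S W \<cdot> \<iota> j" using h(2) j bH[of j] W by auto
    qed (use h(1) rT SO W in \<open>auto simp: Hom_iff\<close>)
    then show "\<exists>u\<in>Hom C (Cod C q) W. u \<cdot> q = h"
      using is_cokernel_factor[OF q, of h W] h(1) rT by auto
  next
    fix i W h assume i: "0 < i" "i \<le> n" and h: "h \<in> Hom C (FO i X) W"
      "\<forall>j>0. j \<le> n \<longrightarrow> h \<cdot> FA i (\<alpha> j) = Zero C (FO i (FO j X)) W"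
    have W: "W \<in> Ob C" using h Hom_Ob by blast
    have "h \<cdot> FA i r = Zero C (FO i S) W"
    proof (rule biproduct_ext[OF FA_biproduct[OF i _ B]])
      fix j assume j: "j \<in> {1..n}"
      then have "(h \<cdot> FA i r) \<cdot> FA i (\<iota> j) = h \<cdot> FA i (r \<cdot> \<iota> j)"
        using bH[of j] rT h(1) i by (auto simp: Hom_iff)
      then show "(h \<cdot> FA i r) \<cdot> FA i (\<iota> j) = Zero C (FO i S) W \<cdot> FA i (\<iota> j)"
        using h(2) j bH[of j] W r(2)[OF j] i by auto
    qed (use h(1) rT SO W i in \<open>auto simp: Hom_iff\<close>)
    then show "\<exists>u\<in>Hom C (FO i (Cod C q)) W. u \<cdot> FA i q = h"
      using is_cokernel_factor[OF FA_cokernel[OF i q], of h W] h(1) rT qT i by auto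
  qed (use qT in auto)
  moreover have "Cod C q = C_ob C n F (X, \<alpha>)"
    by (simp add: C_ob_def coker_def S q_def r_def del: One_nat_def)
  ultimately show ?thesis using that by blast
qed

text \<open>The right adjoint of \<open>C\<close> sends \<open>Y\<close> to \<open>(Y, 0)\<close> and preserves epimorphisms.\<close>

lemma projective_C_ob:
  assumes p: "projective E (X, \<alpha>)"
  shows "projective C (C_ob C n F (X, \<alpha>))"
proof -
  have XE: "(X, \<alpha>) \<in> Ob E" using p by (simp add: projective_def)
  note X = E_objectD[OF XE]
  obtain q where q: "row_cokernel X \<alpha> q" and Q: "Cod C q = C_ob C n F (X, \<alpha>)"
    using C_ob_row_cokernel[OF XE] .
  note dq = row_cokernelD[OF q]
  \<comment> \<open>The zero structure. Arrows from \<open>(X, \<alpha>)\<close> into it are the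
    arrows that kill every \<open>\<alpha> i\<close>, that is, those factoring through
    \<open>q\<close>.\<close>
  define z where "z Y = (\<lambda>i \<in> {1..n}. Zero C (FO i Y) Y)" for Y
  have zE: "(Y, z Y) \<in> Ob E" if "Y \<in> Ob C" for Y
    by (rule E_objectI) (use that in \<open>auto simp: z_def Hom_iff\<close>)
  have z: "z Y i = Zero C (FO i Y) Y" if "0 < i" "i \<le> n" for Y i
    using that by (auto simp: z_def)
  show ?thesis
    unfolding Q[symmetric] projective_def
  proof (intro conjI allI impI ballI)
    show "Cod C q \<in> Ob C" using dq by simp
    fix e g assume e: "is_epi C e" and g: "g \<in> Hom C (Cod C q) (Cod C e)"
    have eA: "e \<in> Ar C" using e by (rule is_epi_Ar)
    have gA: "g \<in> Ar C" "Dom C g = Cod C q" "Cod C g = Cod C e" using g by (auto simp: Hom_iff)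
    let ?Y = "(Dom C e, z (Dom C e))" and ?W = "(Cod C e, z (Cod C e))"
    have eE: "E_map ?Y ?W e"
      by (rule E_mapI) (use zE eA z in \<open>auto simp: Hom_iff\<close>)
    have gE: "E_map (X, \<alpha>) ?W (g \<cdot> q)"
    proof (rule E_mapI)
      fix i assume i: "0 < i" "i \<le> n"
      have "(g \<cdot> q) \<cdot> \<alpha> i = g \<cdot> (q \<cdot> \<alpha> i)" using i gA dq(1-3) X(1-4) by simp
      then show "(g \<cdot> q) \<cdot> \<alpha> i = z (Cod C e) i \<cdot> FA i (g \<cdot> q)"
        using i gA eA dq X(1) z[OF i] by (simp del: FA_Comp)
    qed (use XE zE eA gA dq in \<open>auto simp: Hom_iff\<close>)
    have "\<exists>h \<in> Hom E (X, \<alpha>) ?Y. Comp E (?Y, ?W, e) h = ((X, \<alpha>), ?W, g \<cdot> q)"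
      using p E_epiI[OF eE e] gE unfolding projective_def by (force simp: E_Hom_iff)
    then obtain h where h: "E_map (X, \<alpha>) ?Y h" "e \<cdot> h = g \<cdot> q"
      by (auto simp: E_Hom_iff)
    note dh = E_mapD[OF h(1)]
    obtain u where u: "u \<in> Hom C (Cod C q) (Dom C e)" "u \<cdot> q = h"
      by (rule row_cokernel_factor[OF q, of h "Dom C e"]) (use dh z eA in \<open>auto simp: Hom_iff\<close>)
    have "e \<cdot> u = g"
      by (rule is_epiD[OF dq(3)]) (use u h(2) gA eA dq(1,2) in \<open>auto simp: Hom_iff\<close>)
    then show "\<exists>h\<in>Hom C (Cod C q) (Dom C e). e \<cdot> h = g" using u by blast
  qed
qed

text \<open>The complement is the kernel of the retraction in \<open>C\<close>, which inherits a structure.\<close>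

lemma direct_summand_if_retract:
  assumes s: "E_map S T s" and e: "E_map T S e" and es: "e \<cdot> s = Ident C (fst S)"
  shows "direct_summand E S T"
proof -
  obtain X \<alpha> B \<kappa> where st: "S = (X, \<alpha>)" "T = (B, \<kappa>)" by (cases S; cases T)
  note ds = E_mapD[OF s[unfolded st]] and de = E_mapD[OF e[unfolded st]]
  note X = E_objectD[OF ds(1)] and B = E_objectD[OF ds(2)]
  have es': "e \<cdot> s = Ident C X" using es st by simp
  obtain k where k: "is_kernel C e k" using kernels_exist[OF de(3)] by blast
  define K where "K = Dom C k"
  have dk: "k \<in> Ar C" "Dom C k = K" "Cod C k = B" "e \<cdot> k = Zero C K X"
    using is_kernelD[OF k] de by (auto simp: K_def)
  have KO: "K \<in> Ob C" using dk by auto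
  have km: "is_mono C k" using k by (rule is_kernel_mono)
  \<comment> \<open>\<open>\<kappa> i\<close> restricts to the kernel, since \<open>e\<close>
    carries \<open>\<kappa> i \<cdot> FA i k\<close> to
    \<open>\<alpha> i \<cdot> FA i (e \<cdot> k)\<close>, which is zero.\<close>
  have "\<exists>w. w \<in> Hom C (FO i K) K \<and> k \<cdot> w = \<kappa> i \<cdot> FA i k" if i: "0 < i" "i \<le> n" for i
  proof -
    have "e \<cdot> (\<kappa> i \<cdot> FA i k) = (e \<cdot> \<kappa> i) \<cdot> FA i k" using i de(1-5) dk B(1-4) by simp
    also have "\<dots> = \<alpha> i \<cdot> FA i (e \<cdot> k)" using i de dk(1-3) X(1-4) by simp
    also have "\<dots> = Zero C (FO i K) X" using dk(4) i KO X by simp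
    finally have "e \<cdot> (\<kappa> i \<cdot> FA i k) = Zero C (FO i K) (Cod C e)" using de by simp
    moreover have "\<kappa> i \<cdot> FA i k \<in> Hom C (FO i K) (Dom C e)"
      using i de dk B(1-4) by (simp add: Hom_iff)
    ultimately show ?thesis
      using is_kernel_factor[OF k, of "\<kappa> i \<cdot> FA i k" "FO i K"] dk(2) by metis
  qed
  then obtain w' where w': "\<And>i. 0 < i \<Longrightarrow> i \<le> n \<Longrightarrow> w' i \<in> Hom C (FO i K) K \<and> k \<cdot> w' i = \<kappa> i \<cdot> FA i k"
    by metis
  define w where "w = restrict w' {1..n}"
  have w: "w i \<in> Ar C" "Dom C (w i) = FO i K" "Cod C (w i) = K" "k \<cdot> w i = \<kappa> i \<cdot> FA i k"
    if "0 < i" "i \<le> n" for i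
    using w'[OF that] that by (auto simp: w_def Hom_iff)
  \<comment> \<open>The structure equations for \<open>w\<close> are tested after the monomorphism
    \<open>k\<close>, which is cancelled on the left; the \<open>FA i k\<close> need not be
    monomorphisms for this.\<close>
  have key: "k \<cdot> (w i \<cdot> FA i (w j)) = (\<kappa> i \<cdot> FA i (\<kappa> j)) \<cdot> FA i (FA j k)"
    if i: "0 < i" "i \<le> n" and j: "0 < j" "j \<le> n" for i j
  proof -
    have "k \<cdot> (w i \<cdot> FA i (w j)) = (k \<cdot> w i) \<cdot> FA i (w j)"
      using i j w(1-3) dk(1-3) by simp
    also have "\<dots> = \<kappa> i \<cdot> FA i (k \<cdot> w j)"
      using i j w(1-3) w(4)[OF i] dk(1-3) B(1-4) by simp
    also have "\<dots> = (\<kappa> i \<cdot> FA i (\<kappa> j)) \<cdot> FA i (FA j k)"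
      using i j w(4)[OF j] dk(1-3) B(1-4) by simp
    finally show ?thesis .
  qed
  have KE: "(K, w) \<in> Ob E"
  proof (rule E_objectI)
    fix i j assume i: "0 < i" "i \<le> n" and j: "0 < j" "j \<le> n"
    { assume ij: "i + j \<le> n"
      have "k \<cdot> (w i \<cdot> FA i (w j)) = \<kappa> (i + j) \<cdot> (\<Phi> i j B \<cdot> FA i (FA j k))"
        using key[OF i j] B(5)[OF i j ij] i j ij dk(1-3) B(1-4) by simp
      also have "\<dots> = (\<kappa> (i + j) \<cdot> FA (i + j) k) \<cdot> \<Phi> i j K"
        using i j ij dk(1-3) B(1-4) KO \<Phi>_natural[of i j k K B] by (simp add: Hom_iff)
      also have "\<dots> = k \<cdot> (w (i + j) \<cdot> \<Phi> i j K)"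
        using i j ij w(4)[of "i + j", symmetric] w(1-3) dk(1-3) KO by simp
      finally show "w i \<cdot> FA i (w j) = w (i + j) \<cdot> \<Phi> i j K"
        by (rule is_monoD[OF km]) (use i j ij w(1-3) dk KO in auto) }
    { assume ij: "\<not> i + j \<le> n"
      have "k \<cdot> (w i \<cdot> FA i (w j)) = k \<cdot> Zero C (FO i (FO j K)) K"
        using key[OF i j] B(1) B(6)[OF i j ij] dk(1-3) KO i j by simp
      then show "w i \<cdot> FA i (w j) = Zero C (FO i (FO j K)) K"
        by (rule is_monoD[OF km]) (use i j ij w(1-3) dk KO in auto) }
  qed (use KO w in \<open>auto simp: w_def Hom_iff\<close>)
  have kE: "E_map (K, w) T k"
    unfolding st by (rule E_mapI) (use KE dk w ds in \<open>auto simp: Hom_iff\<close>)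
  have se: "s \<cdot> e \<in> Hom C B B" using ds de by (simp add: Hom_iff)
  \<comment> \<open>\<open>m\<close> is the negative of \<open>s \<cdot> e\<close>, so
    \<open>d\<close> is the complementary idempotent; it will factor through \<open>k\<close> as the
    projection \<open>p\<close>.\<close>
  obtain m where m: "m \<in> Hom C B B" "Add C (s \<cdot> e) m = Zero C B B"
    using Add_inverse_exists[OF se] .
  define d where "d = Add C (Ident C B) m"
  have d: "d \<in> Ar C" "Dom C d = B" "Cod C d = B"
    using m B(1) by (auto simp: d_def Hom_iff)
  have iB: "Ident C B \<in> Hom C B B" using B(1) by (simp add: Hom_iff)
  have sed: "Add C (s \<cdot> e) d = Ident C B"
  proof -
    have "Add C (s \<cdot> e) d = Add C (Ident C B) (Add C (s \<cdot> e) m)"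
      unfolding d_def using Add_assoc[OF se iB m(1)] Add_assoc[OF iB se m(1)] Add_commute[OF se iB]
      by simp
    then show ?thesis using m(2) B(1) by simp
  qed
  have ed: "e \<cdot> d = Zero C B X"
  proof (rule Add_right_cancel[of _ B X _ e])
    have "Add C (e \<cdot> d) e = Add C (e \<cdot> d) (e \<cdot> (s \<cdot> e))"
      using es' ds de d Comp_reduce[OF es', of e] by simp
    also have "\<dots> = e \<cdot> Add C (s \<cdot> e) d"
      using ds de d Add_commute[of "s \<cdot> e" B B d] by (simp add: Comp_Add_right' Hom_iff)
    also have "\<dots> = Add C (Zero C B X) e" using sed de B X by simp
    finally show "Add C (e \<cdot> d) e = Add C (Zero C B X) e" .
  qed (use ds de d B X in \<open>auto simp: Hom_iff\<close>)
  obtain p where p: "p \<in> Hom C B K" "k \<cdot> p = d"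
    using is_kernel_factor[OF k, of d B] d de ed dk(2) by (auto simp: Hom_iff)
  have pA: "p \<in> Ar C" "Dom C p = B" "Cod C p = K" using p by (auto simp: Hom_iff)
  have seE: "E_map T T (s \<cdot> e)" by (rule E_map_Comp[OF e s])
  \<comment> \<open>The identity and \<open>s \<cdot> e\<close> commute with \<kappa>, hence so does
    their difference \<open>d\<close>; cancelling a common summand replaces the subtraction.\<close>
  have dE: "d \<cdot> \<kappa> i = \<kappa> i \<cdot> FA i d" if i: "0 < i" "i \<le> n" for i
  proof (rule Add_right_cancel[of _ "FO i B" B _ "s \<cdot> e \<cdot> \<kappa> i"])
    have "Add C (d \<cdot> \<kappa> i) (s \<cdot> e \<cdot> \<kappa> i) = Add C (s \<cdot> e) d \<cdot> \<kappa> i"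
      using i ds(3-5) de(3-5) d B(1-4) Add_commute[of "s \<cdot> e" B B d]
      by (simp add: Comp_Add_left' Hom_iff)
    also have "\<dots> = \<kappa> i \<cdot> FA i (Add C (s \<cdot> e) d)"
      using sed i B(1-4) by simp
    also have "\<dots> = Add C (\<kappa> i \<cdot> FA i d) (\<kappa> i \<cdot> FA i (s \<cdot> e))"
      using i ds(3-5) de(3-5) d B(1-4) se Add_commute[of "s \<cdot> e" B B d] FA_Add[of i d B B "s \<cdot> e"]
      by (simp add: Comp_Add_right' Hom_iff)
    also have "\<kappa> i \<cdot> FA i (s \<cdot> e) = s \<cdot> e \<cdot> \<kappa> i"
      using E_mapD(6)[OF seE[unfolded st] i] i ds(3-5) de(3-5) B(1-4) by simp
    finally show "Add C (d \<cdot> \<kappa> i) (s \<cdot> e \<cdot> \<kappa> i) = Add C (\<kappa> i \<cdot> FA i d) (s \<cdot> e \<cdot> \<kappa> i)" .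
  qed (use i ds(3-5) de(3-5) d B(1-4) in \<open>auto simp: Hom_iff\<close>)
  have pE: "E_map T (K, w) p"
    unfolding st
  proof (rule E_mapI)
    fix i assume i: "0 < i" "i \<le> n"
    have "k \<cdot> (p \<cdot> \<kappa> i) = \<kappa> i \<cdot> FA i (k \<cdot> p)"
      using i pA p(2) dk(1-3) B(1-4) dE[OF i] Comp_reduce[OF p(2), of "\<kappa> i"] by simp
    also have "\<dots> = (k \<cdot> w i) \<cdot> FA i p"
      using i pA dk(1-3) B(1-4) w(4)[OF i] by simp
    also have "\<dots> = k \<cdot> (w i \<cdot> FA i p)" using i pA dk(1-3) w(1-3) by simp
    finally show "p \<cdot> \<kappa> i = w i \<cdot> FA i p"
      by (rule is_monoD[OF km]) (use i pA dk w(1-3) B in auto)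
  qed (use ds KE p in auto)
  have ds0: "d \<cdot> s = Zero C X B"
  proof (rule Add_right_cancel[of _ X B _ s])
    have "Add C (d \<cdot> s) s = Add C (s \<cdot> e) d \<cdot> s"
      using ds de d es' Add_commute[of "s \<cdot> e" B B d] by (simp add: Comp_Add_left' Hom_iff)
    also have "\<dots> = Add C (Zero C X B) s" using sed ds B X by simp
    finally show "Add C (d \<cdot> s) s = Add C (Zero C X B) s" .
  qed (use ds de d B X in \<open>auto simp: Hom_iff\<close>)
  have ps: "p \<cdot> s = Zero C X K"
  proof (rule is_monoD[OF km])
    show "k \<cdot> p \<cdot> s = k \<cdot> Zero C X K"
      using Comp_reduce[OF p(2), of s] ds0 pA ds dk X KO by simp
  qed (use pA ds dk X KO in auto)
  have dk0: "d \<cdot> k = k"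
  proof -
    have "k = Add C (s \<cdot> e) d \<cdot> k" using sed dk by simp
    also have "\<dots> = d \<cdot> k" using ds(3-5) de(3-5) d dk X KO B(1) by (simp add: Comp_Add_left')
    finally show ?thesis by simp
  qed
  have pk: "p \<cdot> k = Ident C K"
  proof (rule is_monoD[OF km])
    show "k \<cdot> p \<cdot> k = k \<cdot> Ident C K"
      using Comp_reduce[OF p(2), of k] dk0 pA dk KO by simp
  qed (use pA dk KO in auto)
  define I P where "I = (\<lambda>j::nat. if j = 0 then (S, T, s) else ((K, w), T, k))"
    and "P = (\<lambda>j::nat. if j = 0 then (T, S, e) else (T, (K, w), p))"
  have TO: "T \<in> Ob E" "S \<in> Ob E" using ds st by auto
  have "is_biproduct E {0, 1::nat} (\<lambda>j. if j = 0 then S else (K, w)) T I P"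
    unfolding is_biproduct_def
  proof (intro conjI ballI)
    \<comment> \<open>The sum over \<open>{0, 1}\<close> becomes \<open>s \<cdot> e\<close> plus
      \<open>k \<cdot> p\<close>, and \<open>k \<cdot> p\<close> is \<open>d\<close>.\<close>
    interpret G: comm_monoid "hom_group E T T" by (rule E_hom_monoid) (use TO in auto)
    have c: "(T, T, s \<cdot> e) \<in> Hom E T T" "(T, T, k \<cdot> p) \<in> Hom E T T"
      using E_map_Comp[OF e s] E_map_Comp[OF pE kE] by (auto simp: E_Hom_iff)
    have "hom_sum E T T (\<lambda>j. Comp E (I j) (P j)) {0, 1} = Add E (T, T, s \<cdot> e) (T, T, k \<cdot> p)"
      using c G.r_one[of "(T, T, k \<cdot> p)"] G.finprod_empty[of "\<lambda>j. Comp E (I j) (P j)"]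
        G.finprod_insert[of "{}" 1 "\<lambda>j. Comp E (I j) (P j)"]
        G.finprod_insert[of "{1}" 0 "\<lambda>j. Comp E (I j) (P j)"]
      by (simp add: I_def P_def hom_group_def hom_sum_def Pi_def del: One_nat_def)
    then show "hom_sum E T T (\<lambda>j. Comp E (I j) (P j)) {0, 1} = Ident E T"
      using sed p(2) st by (simp add: E_Ident)
  next
    fix j l :: nat assume "j \<in> {0, 1}" "l \<in> {0, 1}"
    then show "Comp E (P l) (I j) = (if j = l then Ident E (if j = 0 then S else (K, w))
      else Zero E (if j = 0 then S else (K, w)) (if l = 0 then S else (K, w)))"
      using es ps pk dk(4) st by (auto simp: I_def P_def E_Ident E_Zero)
  qed (use TO KE s e kE pE in \<open>auto simp: I_def P_def E_Hom_iff\<close>)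
  then show ?thesis unfolding direct_summand_def by blast
qed

end

section \<open>The functor \<open>T\<close>\<close>

text \<open>\<open>biproduct\<close> is an arbitrary choice. Naming its components by an equation
  makes \<open>T_ob\<close> the pair \<open>(B, \<kappa>)\<close> and allows rewriting with its
  injections and projections.\<close>

locale T_object = n_trivial_extension +
  fixes P B \<iota> \<pi>
  assumes P_Ob [simp]: "P \<in> Ob C"
    and biproduct_eq: "biproduct C {0..n} (\<lambda>j. if j = 0 then P else FO j P) = (B, \<iota>, \<pi>)"
begin

definition "\<kappa> = snd (T_ob C n F \<Phi> P)"

lemma T_ob_eq: "T_ob C n F \<Phi> P = (B, \<kappa>)"
  by (simp add: \<kappa>_def T_ob_def biproduct_eq)

lemma is_biproduct_B: "is_biproduct C {0..n} (\<lambda>j. if j = 0 then P else FO j P) B \<iota> \<pi>"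
  by (rule biproduct_spec[OF _ _ biproduct_eq]) auto

lemma B_Ob [simp]: "B \<in> Ob C"
  using is_biproduct_B unfolding is_biproduct_def by blast

lemma \<iota>0_typing [simp]: "\<iota> 0 \<in> Ar C" "Dom C (\<iota> 0) = P" "Cod C (\<iota> 0) = B"
  and \<pi>0_typing [simp]: "\<pi> 0 \<in> Ar C" "Dom C (\<pi> 0) = B" "Cod C (\<pi> 0) = P"
  using biproduct_Hom[OF is_biproduct_B, of 0] by (auto simp: Hom_iff)

lemma \<iota>_typing [simp]:
  assumes "0 < i" "i \<le> n"
  shows "\<iota> i \<in> Ar C" "Dom C (\<iota> i) = FO i P" "Cod C (\<iota> i) = B"
  using biproduct_Hom[OF is_biproduct_B, of i] assms by (auto simp: Hom_iff)

lemma \<pi>_typing [simp]: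
  assumes "0 < i" "i \<le> n"
  shows "\<pi> i \<in> Ar C" "Dom C (\<pi> i) = B" "Cod C (\<pi> i) = FO i P"
  using biproduct_Hom[OF is_biproduct_B, of i] assms by (auto simp: Hom_iff)

lemma B_ext:
  assumes "u \<in> Hom C B Y" "v \<in> Hom C B Y" "u \<cdot> \<iota> 0 = v \<cdot> \<iota> 0"
    and "\<And>j. 0 < j \<Longrightarrow> j \<le> n \<Longrightarrow> u \<cdot> \<iota> j = v \<cdot> \<iota> j"
  shows "u = v"
proof (rule biproduct_ext[OF is_biproduct_B _ assms(1,2)])
  show "u \<cdot> \<iota> j = v \<cdot> \<iota> j" if "j \<in> {0..n}" for j
    using that assms(3,4) by (cases "j = 0") auto
qed simp

lemma FA_B_ext:
  assumes "0 < i" "i \<le> n" "u \<in> Hom C (FO i B) Y" "v \<in> Hom C (FO i B) Y"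
    and "u \<cdot> FA i (\<iota> 0) = v \<cdot> FA i (\<iota> 0)"
    and "\<And>j. 0 < j \<Longrightarrow> j \<le> n \<Longrightarrow> u \<cdot> FA i (\<iota> j) = v \<cdot> FA i (\<iota> j)"
  shows "u = v"
proof (rule biproduct_ext[OF FA_biproduct[OF assms(1,2) _ is_biproduct_B] _ assms(3,4)])
  show "u \<cdot> FA i (\<iota> j) = v \<cdot> FA i (\<iota> j)" if "j \<in> {0..n}" for j
    using that assms(5,6) by (cases "j = 0") auto
qed simp_all

text \<open>The two sides of a structure equation for \<open>T P\<close> start at a twofold image of
  \<open>B\<close>, so they are compared on the twofold images of the injections.\<close>

lemma FA_FA_B_ext:
  assumes "0 < i" "i \<le> n" "0 < k" "k \<le> n" "u \<in> Hom C (FO i (FO k B)) Y" "v \<in> Hom C (FO i (FO k B)) Y"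
    and "u \<cdot> FA i (FA k (\<iota> 0)) = v \<cdot> FA i (FA k (\<iota> 0))"
    and "\<And>j. 0 < j \<Longrightarrow> j \<le> n \<Longrightarrow> u \<cdot> FA i (FA k (\<iota> j)) = v \<cdot> FA i (FA k (\<iota> j))"
  shows "u = v"
proof (rule biproduct_ext[OF FA_biproduct[OF assms(1,2) _ FA_biproduct[OF assms(3,4) _ is_biproduct_B]] _ assms(5,6)])
  show "u \<cdot> FA i (FA k (\<iota> j)) = v \<cdot> FA i (FA k (\<iota> j))" if "j \<in> {0..n}" for j
    using that assms(7,8) by (cases "j = 0") auto
qed simp_all

lemma \<pi>_\<iota>:
  "\<pi> 0 \<cdot> \<iota> 0 = Ident C P"
  "0 < i \<Longrightarrow> i \<le> n \<Longrightarrow> \<pi> 0 \<cdot> \<iota> i = Zero C (FO i P) P"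
  "0 < i \<Longrightarrow> i \<le> n \<Longrightarrow> \<pi> i \<cdot> \<iota> 0 = Zero C P (FO i P)"
  "0 < i \<Longrightarrow> i \<le> n \<Longrightarrow> \<pi> i \<cdot> \<iota> i = Ident C (FO i P)"
  "0 < i \<Longrightarrow> i \<le> n \<Longrightarrow> 0 < j \<Longrightarrow> j \<le> n \<Longrightarrow> i \<noteq> j \<Longrightarrow> \<pi> i \<cdot> \<iota> j = Zero C (FO j P) (FO i P)"
  using biproduct_proj_inj[OF is_biproduct_B, of 0 0] biproduct_proj_inj[OF is_biproduct_B, of i 0]
    biproduct_proj_inj[OF is_biproduct_B, of 0 i] biproduct_proj_inj[OF is_biproduct_B, of i i]
    biproduct_proj_inj[OF is_biproduct_B, of j i]
  by auto

section \<open>The columns of the matrix of \<open>\<kappa> i\<close>\<close>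

context
  fixes i :: nat
  assumes i: "0 < i" "i \<le> n"
begin

private abbreviation (input) "J \<equiv> {j \<in> {1..n}. i + j \<le> n}"
private abbreviation (input) "entry j \<equiv> \<iota> (i + j) \<cdot> (\<Phi> i j P \<cdot> FA i (\<pi> j))"

private lemma entry_Hom: "j \<in> J \<Longrightarrow> entry j \<in> Hom C (FO i B) B"
  using i by (auto simp: Hom_iff)

private lemma entries_Hom: "hom_sum C (FO i B) B (\<lambda>j. entry j) J \<in> Hom C (FO i B) B"
  using i by (intro hom_sum_in_Hom entry_Hom) auto

private lemma \<kappa>_eq: "\<kappa> i = Add C (\<iota> i \<cdot> FA i (\<pi> 0)) (hom_sum C (FO i B) B (\<lambda>j. entry j) J)"
  using i by (simp add: \<kappa>_def T_ob_def biproduct_eq)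

lemma \<kappa>_typing [simp]: "\<kappa> i \<in> Ar C" "Dom C (\<kappa> i) = FO i B" "Cod C (\<kappa> i) = B"
  unfolding \<kappa>_eq using entries_Hom i by (auto simp: Hom_iff)

text \<open>\<open>\<pi> j \<cdot> u\<close> is kept together inside \<open>FA i\<close>: when
  \<open>u\<close> is an injection, the biproduct equations turn it into an identity or a zero
  arrow.\<close>

private lemma \<kappa>_Comp:
  assumes "u \<in> Hom C Y B"
  shows "\<kappa> i \<cdot> FA i u = Add C (\<iota> i \<cdot> FA i (\<pi> 0 \<cdot> u))
    (hom_sum C (FO i Y) B (\<lambda>j. \<iota> (i + j) \<cdot> (\<Phi> i j P \<cdot> FA i (\<pi> j \<cdot> u))) J)"
proof -
  have u: "u \<in> Ar C" "Dom C u = Y" "Cod C u = B" "Y \<in> Ob C" using assms by (auto simp: Hom_iff)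
  have "hom_sum C (FO i B) B (\<lambda>j. entry j) J \<cdot> FA i u
      = hom_sum C (FO i Y) B (\<lambda>j. entry j \<cdot> FA i u) J"
    by (rule hom_sum_Comp[OF _ _ entry_Hom]) (use u i in \<open>auto simp: Hom_iff\<close>)
  also have "\<dots> = hom_sum C (FO i Y) B (\<lambda>j. \<iota> (i + j) \<cdot> (\<Phi> i j P \<cdot> FA i (\<pi> j \<cdot> u))) J"
    by (rule hom_sum_cong) (use u i in \<open>auto simp: Hom_iff\<close>)
  finally show ?thesis
    unfolding \<kappa>_eq using entries_Hom i u by (simp add: Comp_Add_left' Hom_iff)
qed

text \<open>The summand 0 generates: each other injection is the action applied to
  \<open>\<iota> 0\<close>. This gives both the uniqueness in \<open>T_map_ext\<close> and the
  cokernel of the row.\<close>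

lemma \<kappa>_\<iota>0: "\<kappa> i \<cdot> FA i (\<iota> 0) = \<iota> i"
proof -
  have "hom_sum C (FO i P) B (\<lambda>j. \<iota> (i + j) \<cdot> (\<Phi> i j P \<cdot> FA i (\<pi> j \<cdot> \<iota> 0))) J = Zero C (FO i P) B"
    by (rule hom_sum_Zero) (use i \<pi>_\<iota> in auto)
  then show ?thesis
    using \<kappa>_Comp[of "\<iota> 0" P] i \<pi>_\<iota> by (simp add: Hom_iff del: FA_Comp)
qed

lemma \<kappa>_\<iota>:
  assumes k: "0 < k" "k \<le> n"
  shows "\<kappa> i \<cdot> FA i (\<iota> k) = (if i + k \<le> n then \<iota> (i + k) \<cdot> \<Phi> i k P else Zero C (FO i (FO k P)) B)"
proof -
  let ?t = "\<lambda>j. \<iota> (i + j) \<cdot> (\<Phi> i j P \<cdot> FA i (\<pi> j \<cdot> \<iota> k))"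
  have t0: "?t j = Zero C (FO i (FO k P)) B" if "j \<in> J" "j \<noteq> k" for j
    using that i k \<pi>_\<iota>(5)[of j k] by (simp del: FA_Comp)
  have tk: "?t k = \<iota> (i + k) \<cdot> \<Phi> i k P" if "i + k \<le> n"
    using that i k \<pi>_\<iota>(4)[of k] by (simp del: FA_Comp)
  have "hom_sum C (FO i (FO k P)) B ?t J =
      (if i + k \<le> n then \<iota> (i + k) \<cdot> \<Phi> i k P else Zero C (FO i (FO k P)) B)"
  proof (cases "i + k \<le> n")
    case True
    have "hom_sum C (FO i (FO k P)) B ?t J = ?t k"
      by (rule hom_sum_single[OF _ _ _ t0]) (use True i k tk in \<open>auto simp: Hom_iff\<close>)
    then show ?thesis using True tk by simp
  next
    case False
    have "hom_sum C (FO i (FO k P)) B ?t J = Zero C (FO i (FO k P)) B"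
      by (rule hom_sum_Zero[OF _ _ t0]) (use False i k in auto)
    then show ?thesis using False by simp
  qed
  then show ?thesis
    using \<kappa>_Comp[of "\<iota> k" "FO k P"] i k \<pi>_\<iota>(2)[of k] by (auto simp: Hom_iff simp del: FA_Comp)
qed

end

text \<open>Compared column by column, with naturality of \<Phi> moving \<open>\<Phi> i j\<close>
  past the injections: on summand 0 both sides reduce to \<open>\<Phi> i j P\<close>, and on summand
  \<open>k\<close> their equality is associativity of \<Phi>.\<close>

lemma T_in_Ob: "(B, \<kappa>) \<in> Ob E"
proof (rule E_objectI)
  show "\<kappa> \<in> extensional {1..n}" by (simp add: \<kappa>_def T_ob_def biproduct_eq)
  fix i j assume i: "0 < i" "i \<le> n" and j: "0 < j" "j \<le> n"
  have L: "(\<kappa> i \<cdot> FA i (\<kappa> j)) \<cdot> FA i (FA j u) = \<kappa> i \<cdot> FA i (\<kappa> j \<cdot> FA j u)"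
    if "u \<in> Ar C" "Cod C u = B" for u
    using that i j by simp
  have R: "(\<kappa> (i + j) \<cdot> \<Phi> i j B) \<cdot> FA i (FA j u) = (\<kappa> (i + j) \<cdot> FA (i + j) u) \<cdot> \<Phi> i j Y"
    if "i + j \<le> n" "u \<in> Hom C Y B" for u Y
    using that i j \<Phi>_natural[of i j u Y B] by (auto simp: Hom_iff)
  have \<iota>H: "\<iota> 0 \<in> Hom C P B" "\<And>k. 0 < k \<Longrightarrow> k \<le> n \<Longrightarrow> \<iota> k \<in> Hom C (FO k P) B"
    by (auto simp: Hom_iff)
  have L0: "(\<kappa> i \<cdot> FA i (\<kappa> j)) \<cdot> FA i (FA j (\<iota> 0)) =
      (if i + j \<le> n then \<iota> (i + j) \<cdot> \<Phi> i j P else Zero C (FO i (FO j P)) B)"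
    using L[of "\<iota> 0"] \<kappa>_\<iota>0[OF j] \<kappa>_\<iota>[OF i j] by simp
  \<comment> \<open>If \<open>j + k\<close> exceeds \<open>n\<close>, so does
    \<open>i + j + k\<close>: the inner action then vanishes in accordance with the right-hand
    side.\<close>
  have Lk: "(\<kappa> i \<cdot> FA i (\<kappa> j)) \<cdot> FA i (FA j (\<iota> k)) =
      (if i + j + k \<le> n then \<iota> (i + j + k) \<cdot> (\<Phi> (i + j) k P \<cdot> \<Phi> i j (FO k P))
       else Zero C (FO i (FO j (FO k P))) B)" if k: "0 < k" "k \<le> n" for k
  proof (cases "j + k \<le> n")
    case True
    have "(\<kappa> i \<cdot> FA i (\<kappa> j)) \<cdot> FA i (FA j (\<iota> k)) = (\<kappa> i \<cdot> FA i (\<iota> (j + k))) \<cdot> FA i (\<Phi> j k P)"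
      using L[of "\<iota> k"] \<kappa>_\<iota>[OF j k] i j k True by simp
    also have "\<dots> = (if i + j + k \<le> n then \<iota> (i + j + k) \<cdot> (\<Phi> (i + j) k P \<cdot> \<Phi> i j (FO k P))
       else Zero C (FO i (FO j (FO k P))) B)"
      using \<kappa>_\<iota>[OF i, of "j + k"] i j k True \<Phi>_associative[of i j k P] by (auto simp: add.assoc)
    finally show ?thesis .
  next
    case False
    then show ?thesis using L[of "\<iota> k"] \<kappa>_\<iota>[OF j k] i j k by simp
  qed
  { assume ij: "i + j \<le> n"
    show "\<kappa> i \<cdot> FA i (\<kappa> j) = \<kappa> (i + j) \<cdot> \<Phi> i j B"
    proof (rule FA_FA_B_ext[OF i j])
      show "(\<kappa> i \<cdot> FA i (\<kappa> j)) \<cdot> FA i (FA j (\<iota> 0)) = (\<kappa> (i + j) \<cdot> \<Phi> i j B) \<cdot> FA i (FA j (\<iota> 0))"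
        unfolding L0 R[OF ij \<iota>H(1)] using \<kappa>_\<iota>0[of "i + j"] ij i by simp
      fix k assume k: "0 < k" "k \<le> n"
      show "(\<kappa> i \<cdot> FA i (\<kappa> j)) \<cdot> FA i (FA j (\<iota> k)) = (\<kappa> (i + j) \<cdot> \<Phi> i j B) \<cdot> FA i (FA j (\<iota> k))"
        unfolding Lk[OF k] R[OF ij \<iota>H(2)[OF k]] using \<kappa>_\<iota>[of "i + j" k] ij i j k by simp
    qed (use i j ij in \<open>auto simp: Hom_iff\<close>) }
  { assume ij: "\<not> i + j \<le> n"
    show "\<kappa> i \<cdot> FA i (\<kappa> j) = Zero C (FO i (FO j B)) B"
    proof (rule FA_FA_B_ext[OF i j])
      show "(\<kappa> i \<cdot> FA i (\<kappa> j)) \<cdot> FA i (FA j (\<iota> 0)) = Zero C (FO i (FO j B)) B \<cdot> FA i (FA j (\<iota> 0))"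
        unfolding L0 using ij i j by simp
      fix k assume k: "0 < k" "k \<le> n"
      show "(\<kappa> i \<cdot> FA i (\<kappa> j)) \<cdot> FA i (FA j (\<iota> k)) = Zero C (FO i (FO j B)) B \<cdot> FA i (FA j (\<iota> k))"
        unfolding Lk[OF k] using ij i j k by simp
    qed (use i j ij in \<open>auto simp: Hom_iff\<close>) }
qed (auto simp: Hom_iff)

text \<open>\<open>T\<close> is left adjoint to the forgetful functor.\<close>

lemma T_lift:
  assumes YE: "(Y, \<beta>) \<in> Ob E" and \<gamma>: "\<gamma> \<in> Hom C P Y"
  obtains \<phi> where "E_map (B, \<kappa>) (Y, \<beta>) \<phi>" "\<phi> \<cdot> \<iota> 0 = \<gamma>"
    "\<And>j. 0 < j \<Longrightarrow> j \<le> n \<Longrightarrow> \<phi> \<cdot> \<iota> j = \<beta> j \<cdot> FA j \<gamma>"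
proof -
  note Y = E_objectD[OF YE]
  have g: "\<gamma> \<in> Ar C" "Dom C \<gamma> = P" "Cod C \<gamma> = Y" using \<gamma> by (auto simp: Hom_iff)
  \<comment> \<open>These values are forced: \<open>\<iota> j\<close> is
    \<open>\<kappa> j \<cdot> FA j (\<iota> 0)\<close>, and \<phi> has to carry \<kappa> to
    \<beta>.\<close>
  define c where "c j = (if j = 0 then \<gamma> else \<beta> j \<cdot> FA j \<gamma>)" for j
  define \<phi> where "\<phi> = hom_sum C B Y (\<lambda>j. c j \<cdot> \<pi> j) {0..n}"
  have c: "c j \<in> Hom C (if j = 0 then P else FO j P) Y" if "j \<in> {0..n}" for j
    using that g Y(1-4) by (auto simp: c_def Hom_iff)
  have \<phi>: "\<phi> \<in> Hom C B Y" "\<And>j. j \<in> {0..n} \<Longrightarrow> \<phi> \<cdot> \<iota> j = c j"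
    unfolding \<phi>_def using biproduct_copair[OF is_biproduct_B _ Y(1) c] by auto
  have \<phi>T: "\<phi> \<in> Ar C" "Dom C \<phi> = B" "Cod C \<phi> = Y" using \<phi>(1) by (auto simp: Hom_iff)
  have \<phi>0: "\<phi> \<cdot> \<iota> 0 = \<gamma>" and \<phi>k: "\<And>j. 0 < j \<Longrightarrow> j \<le> n \<Longrightarrow> \<phi> \<cdot> \<iota> j = \<beta> j \<cdot> FA j \<gamma>"
    using \<phi>(2) by (auto simp: c_def)
  have "E_map (B, \<kappa>) (Y, \<beta>) \<phi>"
  proof (rule E_mapI[OF T_in_Ob YE \<phi>(1)])
    fix i assume i: "0 < i" "i \<le> n"
    show "\<phi> \<cdot> \<kappa> i = \<beta> i \<cdot> FA i \<phi>"
    proof (rule FA_B_ext[OF i])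
      have "(\<beta> i \<cdot> FA i \<phi>) \<cdot> FA i (\<iota> 0) = \<beta> i \<cdot> FA i (\<phi> \<cdot> \<iota> 0)"
        using i \<phi>T Y(1-4) by simp
      then show "(\<phi> \<cdot> \<kappa> i) \<cdot> FA i (\<iota> 0) = (\<beta> i \<cdot> FA i \<phi>) \<cdot> FA i (\<iota> 0)"
        using \<phi>0 \<phi>k[OF i] \<kappa>_\<iota>0[OF i] i \<phi>T by simp
      fix k assume k: "0 < k" "k \<le> n"
      have "(\<beta> i \<cdot> FA i \<phi>) \<cdot> FA i (\<iota> k) = \<beta> i \<cdot> FA i (\<phi> \<cdot> \<iota> k)"
        using i k \<phi>T Y(1-4) by simp
      also have "\<dots> = (\<beta> i \<cdot> FA i (\<beta> k)) \<cdot> FA i (FA k \<gamma>)"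
        unfolding \<phi>k[OF k] using i k g Y(1-4) by simp
      finally have R: "(\<beta> i \<cdot> FA i \<phi>) \<cdot> FA i (\<iota> k) = (\<beta> i \<cdot> FA i (\<beta> k)) \<cdot> FA i (FA k \<gamma>)" .
      have L: "(\<phi> \<cdot> \<kappa> i) \<cdot> FA i (\<iota> k) = \<phi> \<cdot> (\<kappa> i \<cdot> FA i (\<iota> k))"
        using i k \<phi>T by simp
      show "(\<phi> \<cdot> \<kappa> i) \<cdot> FA i (\<iota> k) = (\<beta> i \<cdot> FA i \<phi>) \<cdot> FA i (\<iota> k)"
      \<comment> \<open>The two cases of the action on summand \<open>k\<close> match the two
        structure equations of \<open>(Y, \<beta>)\<close>; in the first one they are linked by
        naturality of \<Phi> at \<gamma>.\<close>
      proof (cases "i + k \<le> n")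
        case True
        have "(\<phi> \<cdot> \<kappa> i) \<cdot> FA i (\<iota> k) = (\<phi> \<cdot> \<iota> (i + k)) \<cdot> \<Phi> i k P"
          unfolding L \<kappa>_\<iota>[OF i k] using True i k \<phi>T by simp
        also have "\<dots> = \<beta> (i + k) \<cdot> (FA (i + k) \<gamma> \<cdot> \<Phi> i k P)"
          using \<phi>k[of "i + k"] True i k g Y(1-4) by simp
        also have "\<dots> = (\<beta> i \<cdot> FA i (\<beta> k)) \<cdot> FA i (FA k \<gamma>)"
          unfolding Y(5)[OF i k True] using \<Phi>_natural[OF i(1) k(1) True \<gamma>] True i k g Y(1-4) by simp
        finally show ?thesis using R by simp
      next
        case False
        show ?thesis unfolding R L \<kappa>_\<iota>[OF i k] Y(6)[OF i k False]
          using False i k g \<phi>T Y(1) by simp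
      qed
    qed (use i \<phi>T Y(1-4) in \<open>auto simp: Hom_iff\<close>)
  qed
  then show ?thesis using that \<phi>0 \<phi>k by blast
qed

text \<open>The uniqueness half of the adjunction: the restriction to summand \<open>j\<close> is
  determined through \<open>\<kappa> j\<close> by the one to summand 0.\<close>

lemma T_map_ext:
  assumes u: "E_map (B, \<kappa>) (Y, \<beta>) u" and v: "E_map (B, \<kappa>) (Y, \<beta>) v" and eq: "u \<cdot> \<iota> 0 = v \<cdot> \<iota> 0"
  shows "u = v"
proof (rule B_ext[of _ Y])
  note du = E_mapD[OF u] and dv = E_mapD[OF v]
  note Y = E_objectD[OF du(2)]
  fix j assume j: "0 < j" "j \<le> n"
  have *: "w \<cdot> \<iota> j = \<beta> j \<cdot> FA j (w \<cdot> \<iota> 0)" if w: "E_map (B, \<kappa>) (Y, \<beta>) w" for w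
  proof -
    note dw = E_mapD[OF w]
    have "w \<cdot> \<iota> j = (w \<cdot> \<kappa> j) \<cdot> FA j (\<iota> 0)"
      using \<kappa>_\<iota>0[OF j] j dw(3-5) by simp
    also have "\<dots> = \<beta> j \<cdot> FA j (w \<cdot> \<iota> 0)"
      using dw(3-6) j Y(1-4) by simp
    finally show ?thesis .
  qed
  show "u \<cdot> \<iota> j = v \<cdot> \<iota> j" using *[OF u] *[OF v] eq by simp
qed (use assms E_mapD in \<open>auto simp: Hom_iff\<close>)

lemma projective_T:
  assumes P: "projective C P"
  shows "projective E (B, \<kappa>)"
  unfolding projective_def
proof (intro conjI allI impI ballI)
  show "(B, \<kappa>) \<in> Ob E" by (rule T_in_Ob)
  fix e g assume e: "is_epi E e" and g: "g \<in> Hom E (B, \<kappa>) (Cod E e)"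
  obtain Y \<beta> Z \<zeta> \<epsilon> where eq: "e = ((Y, \<beta>), (Z, \<zeta>), \<epsilon>)" by (metis prod.exhaust)
  have \<epsilon>: "E_map (Y, \<beta>) (Z, \<zeta>) \<epsilon>" using e unfolding eq by (simp add: is_epi_def E_Ar_iff)
  note d\<epsilon> = E_mapD[OF \<epsilon>]
  obtain \<gamma> where \<gamma>: "g = ((B, \<kappa>), (Z, \<zeta>), \<gamma>)" "E_map (B, \<kappa>) (Z, \<zeta>) \<gamma>"
    using g unfolding eq by (auto simp: E_Hom_iff)
  note d\<gamma> = E_mapD[OF \<gamma>(2)]
  have "\<gamma> \<cdot> \<iota> 0 \<in> Hom C P (Cod C \<epsilon>)" using d\<gamma> d\<epsilon> by (simp add: Hom_iff)
  then obtain h where h: "h \<in> Hom C P (Dom C \<epsilon>)" "\<epsilon> \<cdot> h = \<gamma> \<cdot> \<iota> 0"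
    using P E_epiD[OF e[unfolded eq]] unfolding projective_def by blast
  obtain \<eta> where \<eta>: "E_map (B, \<kappa>) (Y, \<beta>) \<eta>" "\<eta> \<cdot> \<iota> 0 = h"
    using T_lift[OF d\<epsilon>(1), of h] h d\<epsilon> by auto
  have "\<epsilon> \<cdot> \<eta> = \<gamma>"
  proof (rule T_map_ext[OF E_map_Comp[OF \<eta>(1) \<epsilon>] \<gamma>(2)])
    show "(\<epsilon> \<cdot> \<eta>) \<cdot> \<iota> 0 = \<gamma> \<cdot> \<iota> 0"
      using h \<eta>(2) E_mapD(3-5)[OF \<eta>(1)] d\<epsilon>(3-5) by simp
  qed
  then show "\<exists>h\<in>Hom E (B, \<kappa>) (Dom E e). Comp E e h = g"
    using \<eta>(1) \<gamma>(1) unfolding eq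
    by (intro bexI[of _ "((B, \<kappa>), (Y, \<beta>), \<eta>)"]) (auto simp: E_Hom_iff)
qed

text \<open>This is the isomorphism of C T with the identity. As \<open>\<iota> j\<close> is
  \<open>\<kappa> j \<cdot> FA j (\<iota> 0)\<close>, an arrow that kills the row vanishes on every
  summand except 0 and so factors through \<open>\<pi> 0\<close>; the same holds after applying
  \<open>F i\<close>.\<close>

lemma \<pi>0_row_cokernel: "row_cokernel B \<kappa> (\<pi> 0)"
  unfolding row_cokernel_def
proof (intro conjI allI impI ballI)
  show "is_epi C (\<pi> 0)"
    by (rule is_epi_if_Comp[of _ "\<iota> 0"]) (use \<pi>_\<iota>(1) is_epi_Ident in auto)
next
  fix i assume i: "0 < i" "i \<le> n"
  show "\<pi> 0 \<cdot> \<kappa> i = Zero C (FO i B) (Cod C (\<pi> 0))"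
  proof (rule FA_B_ext[OF i])
    show "(\<pi> 0 \<cdot> \<kappa> i) \<cdot> FA i (\<iota> 0) = Zero C (FO i B) (Cod C (\<pi> 0)) \<cdot> FA i (\<iota> 0)"
      using i \<kappa>_\<iota>0[OF i] \<pi>_\<iota>(2)[OF i] by simp
    fix k assume k: "0 < k" "k \<le> n"
    show "(\<pi> 0 \<cdot> \<kappa> i) \<cdot> FA i (\<iota> k) = Zero C (FO i B) (Cod C (\<pi> 0)) \<cdot> FA i (\<iota> k)"
      using i k \<kappa>_\<iota>[OF i k] Comp_reduce[OF \<pi>_\<iota>(2)[of "i + k"], of "\<Phi> i k P"] by auto
  qed (use i in \<open>auto simp: Hom_iff\<close>)
next
  fix W h assume h: "h \<in> Hom C B W" "\<forall>j>0. j \<le> n \<longrightarrow> h \<cdot> \<kappa> j = Zero C (FO j B) W"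
  have hT: "h \<in> Ar C" "Dom C h = B" "Cod C h = W" "W \<in> Ob C" using h(1) by (auto simp: Hom_iff)
  \<comment> \<open>The factor can only be \<open>h \<cdot> \<iota> 0\<close>, because
    \<open>\<iota> 0\<close> is a section of \<open>\<pi> 0\<close>.\<close>
  have "(h \<cdot> \<iota> 0) \<cdot> \<pi> 0 = h"
  proof (rule B_ext[of _ W])
    show "((h \<cdot> \<iota> 0) \<cdot> \<pi> 0) \<cdot> \<iota> 0 = h \<cdot> \<iota> 0" using \<pi>_\<iota>(1) hT by simp
    fix j assume j: "0 < j" "j \<le> n"
    have "h \<cdot> \<iota> j = (h \<cdot> \<kappa> j) \<cdot> FA j (\<iota> 0)" using \<kappa>_\<iota>0[OF j] hT j by simp
    then have "h \<cdot> \<iota> j = Zero C (FO j P) W" using h(2) j hT by simp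
    then show "((h \<cdot> \<iota> 0) \<cdot> \<pi> 0) \<cdot> \<iota> j = h \<cdot> \<iota> j" using \<pi>_\<iota>(2)[OF j] hT j by simp
  qed (use hT in \<open>auto simp: Hom_iff\<close>)
  then show "\<exists>u\<in>Hom C (Cod C (\<pi> 0)) W. u \<cdot> \<pi> 0 = h"
    using hT by (intro bexI[of _ "h \<cdot> \<iota> 0"]) (auto simp: Hom_iff)
next
  fix i W h assume i: "0 < i" "i \<le> n" and h: "h \<in> Hom C (FO i B) W"
    "\<forall>j>0. j \<le> n \<longrightarrow> h \<cdot> FA i (\<kappa> j) = Zero C (FO i (FO j B)) W"
  have hT: "h \<in> Ar C" "Dom C h = FO i B" "Cod C h = W" "W \<in> Ob C" using h(1) by (auto simp: Hom_iff)
  have \<pi>\<iota>: "FA i (\<pi> 0) \<cdot> FA i (\<iota> k) = FA i (\<pi> 0 \<cdot> \<iota> k)" if "k \<le> n" for k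
    using i that by (cases "k = 0") auto
  have "(h \<cdot> FA i (\<iota> 0)) \<cdot> FA i (\<pi> 0) = h"
  proof (rule FA_B_ext[OF i, of _ W])
    show "((h \<cdot> FA i (\<iota> 0)) \<cdot> FA i (\<pi> 0)) \<cdot> FA i (\<iota> 0) = h \<cdot> FA i (\<iota> 0)"
      using \<pi>\<iota>[of 0] \<pi>_\<iota>(1) hT i by (simp del: FA_Comp)
    fix j assume j: "0 < j" "j \<le> n"
    have "h \<cdot> FA i (\<iota> j) = (h \<cdot> FA i (\<kappa> j)) \<cdot> FA i (FA j (\<iota> 0))"
      using \<kappa>_\<iota>0[OF j, symmetric] hT i j by simp
    then have "h \<cdot> FA i (\<iota> j) = Zero C (FO i (FO j P)) W" using h(2) i j hT by simp
    then show "((h \<cdot> FA i (\<iota> 0)) \<cdot> FA i (\<pi> 0)) \<cdot> FA i (\<iota> j) = h \<cdot> FA i (\<iota> j)"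
      using \<pi>\<iota>[of j] \<pi>_\<iota>(2)[OF j] hT i j by (simp del: FA_Comp)
  qed (use hT i in \<open>auto simp: Hom_iff\<close>)
  then show "\<exists>u\<in>Hom C (FO i (Cod C (\<pi> 0))) W. u \<cdot> FA i (\<pi> 0) = h"
    using hT i by (intro bexI[of _ "h \<cdot> FA i (\<iota> 0)"]) (auto simp: Hom_iff)
qed auto

end

section \<open>Projective objects of the extension\<close>

context n_trivial_extension
begin

lemma T_object_exists:
  assumes "P \<in> Ob C"
  obtains B \<iota> \<pi> where "T_object C n F \<Phi> P B \<iota> \<pi>"
proof -
  obtain B \<iota> \<pi> where "biproduct C {0..n} (\<lambda>j. if j = 0 then P else FO j P) = (B, \<iota>, \<pi>)"
    by (metis prod_cases3)
  then have "T_object C n F \<Phi> P B \<iota> \<pi>"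
    using assms n_trivial_extension_axioms by (simp add: T_object_def T_object_axioms_def)
  then show ?thesis by (rule that)
qed

lemma projective_T_ob:
  assumes "projective C P"
  shows "projective E (T_ob C n F \<Phi> P)"
proof -
  obtain B \<iota> \<pi> where "T_object C n F \<Phi> P B \<iota> \<pi>"
    using T_object_exists assms unfolding projective_def by blast
  then interpret T_object C n F \<Phi> P B \<iota> \<pi> .
  show ?thesis using projective_T[OF assms] by (simp add: T_ob_eq)
qed

lemma projective_if_direct_summand:
  assumes P: "projective C P" and d: "direct_summand E S (T_ob C n F \<Phi> P)"
  shows "projective E S"
proof -
  obtain Y \<iota> \<pi> where b: "is_biproduct E {0, 1::nat} (\<lambda>k. if k = 0 then S else Y) (T_ob C n F \<Phi> P) \<iota> \<pi>"
    using d unfolding direct_summand_def by blast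
  show ?thesis
    by (rule category.projective_retract[OF category_E projective_T_ob[OF P], of "\<iota> 0" _ "\<pi> 0"])
      (use b in \<open>auto simp: is_biproduct_def\<close>)
qed

lemma direct_summand_if_projective:
  assumes enough: "enough_projectives C" and p: "projective E (X, \<alpha>)"
  shows "\<exists>P. projective C P \<and> direct_summand E (X, \<alpha>) (T_ob C n F \<Phi> P)"
proof -
  have XE: "(X, \<alpha>) \<in> Ob E" using p by (simp add: projective_def)
  note X = E_objectD[OF XE]
  obtain P e where P: "projective C P" "e \<in> Hom C P X" "is_epi C e"
    using enough X(1) unfolding enough_projectives_def by blast
  obtain B \<iota> \<pi> where "T_object C n F \<Phi> P B \<iota> \<pi>"
    using T_object_exists P(1) unfolding projective_def by blast
  then interpret T_object C n F \<Phi> P B \<iota> \<pi> .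
  obtain \<phi> where \<phi>: "E_map (B, \<kappa>) (X, \<alpha>) \<phi>" "\<phi> \<cdot> \<iota> 0 = e" using T_lift[OF XE P(2)] .
  have "is_epi C \<phi>"
    by (rule is_epi_if_Comp[of _ "\<iota> 0"]) (use \<phi> P(3) E_mapD[OF \<phi>(1)] in auto)
  then have "is_epi E ((B, \<kappa>), (X, \<alpha>), \<phi>)" by (rule E_epiI[OF \<phi>(1)])
  moreover have "((X, \<alpha>), (X, \<alpha>), Ident C X) \<in> Hom E (X, \<alpha>) (X, \<alpha>)"
    using E_map_Ident[OF XE] by (simp add: E_Hom_iff)
  \<comment> \<open>Lifting the identity of the projective \<open>(X, \<alpha>)\<close> along \<phi>
    gives a section within the extension.\<close>
  ultimately obtain s where "E_map (X, \<alpha>) (B, \<kappa>) s" "\<phi> \<cdot> s = Ident C X"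
    using p unfolding projective_def by (force simp: E_Hom_iff)
  then have "direct_summand E (X, \<alpha>) (B, \<kappa>)"
    using direct_summand_if_retract[OF _ \<phi>(1)] by simp
  then show ?thesis using P(1) T_ob_eq by metis
qed

lemma T_C_isomorphic_if_projective:
  assumes p: "projective E (X, \<alpha>)"
  shows "isomorphic E (T_ob C n F \<Phi> (C_ob C n F (X, \<alpha>))) (X, \<alpha>)"
proof -
  have XE: "(X, \<alpha>) \<in> Ob E" using p by (simp add: projective_def)
  note X = E_objectD[OF XE]
  define Q where "Q = C_ob C n F (X, \<alpha>)"
  have Q: "projective C Q" unfolding Q_def by (rule projective_C_ob[OF p])
  obtain q where q: "row_cokernel X \<alpha> q" and qQ: "Cod C q = Q"
    using C_ob_row_cokernel[OF XE] unfolding Q_def .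
  note dq = row_cokernelD[OF q]
  have QO: "Q \<in> Ob C" using Q unfolding projective_def by blast
  have "Ident C Q \<in> Hom C Q (Cod C q)" using QO qQ by (simp add: Hom_iff)
  then obtain s where s: "s \<in> Hom C Q X" "q \<cdot> s = Ident C Q"
    using Q dq(2,3) unfolding projective_def by blast
  obtain B \<iota> \<pi> where "T_object C n F \<Phi> Q B \<iota> \<pi>"
    using T_object_exists[OF QO] .
  then interpret T_object C n F \<Phi> Q B \<iota> \<pi> .
  obtain \<phi> where \<phi>: "E_map (B, \<kappa>) (X, \<alpha>) \<phi>" "\<phi> \<cdot> \<iota> 0 = s"
    and \<phi>k: "\<And>j. 0 < j \<Longrightarrow> j \<le> n \<Longrightarrow> \<phi> \<cdot> \<iota> j = \<alpha> j \<cdot> FA j s"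
    using T_lift[OF XE s(1)] by metis
  note d\<phi> = E_mapD[OF \<phi>(1)]
  have sT: "s \<in> Ar C" "Dom C s = Q" "Cod C s = X" using s(1) by (auto simp: Hom_iff)
  \<comment> \<open>\<phi> induces the identity of \<open>Q\<close> on cokernels: on summand 0
    because \<open>s\<close> is a section of \<open>q\<close>, on the others because
    \<open>q\<close> kills the row \<alpha>.\<close>
  have q\<phi>: "q \<cdot> \<phi> = \<pi> 0"
  proof (rule B_ext[of _ Q])
    show "(q \<cdot> \<phi>) \<cdot> \<iota> 0 = \<pi> 0 \<cdot> \<iota> 0" using dq(1,2) d\<phi>(3-5) \<phi>(2) s(2) \<pi>_\<iota>(1) by simp
    fix j assume j: "0 < j" "j \<le> n"
    have "(q \<cdot> \<phi>) \<cdot> \<iota> j = (q \<cdot> \<alpha> j) \<cdot> FA j s"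
      using dq(1,2) d\<phi>(3-5) \<phi>k[OF j] j sT X(1-4) by simp
    then show "(q \<cdot> \<phi>) \<cdot> \<iota> j = \<pi> 0 \<cdot> \<iota> j"
      using dq(4)[OF j] \<pi>_\<iota>(2)[OF j] qQ j sT QO by simp
  qed (use dq(1,2) d\<phi>(3-5) qQ in \<open>auto simp: Hom_iff\<close>)
  have "is_epi C \<phi>"
    by (rule epi_if_row_cokernel_Comp_epi[OF \<phi>(1) q]) (use q\<phi> row_cokernelD(3)[OF \<pi>0_row_cokernel] in simp)
  then have "is_epi E ((B, \<kappa>), (X, \<alpha>), \<phi>)" by (rule E_epiI[OF \<phi>(1)])
  moreover have "((X, \<alpha>), (X, \<alpha>), Ident C X) \<in> Hom E (X, \<alpha>) (X, \<alpha>)"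
    using E_map_Ident[OF XE] by (simp add: E_Hom_iff)
  ultimately obtain \<psi> where \<psi>: "E_map (X, \<alpha>) (B, \<kappa>) \<psi>" "\<phi> \<cdot> \<psi> = Ident C X"
    using p unfolding projective_def by (force simp: E_Hom_iff)
  note d\<psi> = E_mapD[OF \<psi>(1)]
  \<comment> \<open>Since \<phi> has section \<psi>, the previous identity can be read backwards:
    \<psi> also induces the identity on cokernels, and the Nakayama argument applies to it.\<close>
  have "\<pi> 0 \<cdot> \<psi> = q"
    unfolding q\<phi>[symmetric] using \<psi>(2) dq(1,2) d\<phi>(3-5) d\<psi>(3-5) by simp
  then have "is_epi C \<psi>"
    by (intro epi_if_row_cokernel_Comp_epi[OF \<psi>(1) \<pi>0_row_cokernel]) (use dq(3) in simp)
  \<comment> \<open>Both sides agree after composing with the epimorphism \<psi> on the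
    right.\<close>
  then have "\<psi> \<cdot> \<phi> = Ident C B"
    by (rule is_epiD) (use \<psi>(2) d\<phi>(3-5) d\<psi>(3-5) in auto)
  then have "isomorphic E (B, \<kappa>) (X, \<alpha>)"
    unfolding isomorphic_def using \<phi>(1) \<psi> XE T_in_Ob
    by (intro conjI bexI[of _ "((B, \<kappa>), (X, \<alpha>), \<phi>)"] bexI[of _ "((X, \<alpha>), (B, \<kappa>), \<psi>)"])
      (auto simp: E_Hom_iff E_Ident)
  then show ?thesis using T_ob_eq Q_def by simp
qed

lemma projective_if_isomorphic_T_ob:
  assumes P: "projective C P" and iso: "isomorphic E (T_ob C n F \<Phi> P) S"
  shows "projective E S"
proof -
  obtain u v where "u \<in> Hom E (T_ob C n F \<Phi> P) S" "v \<in> Hom E S (T_ob C n F \<Phi> P)"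
    "Comp E u v = Ident E S"
    using iso unfolding isomorphic_def by blast
  then show ?thesis
    using category.projective_retract[OF category_E projective_T_ob[OF P]] by blast
qed

end

theorem corollary3p3:
  fixes A :: "('o, 'm) cat" and n :: nat
    and F :: "nat \<Rightarrow> ('o, 'm, 'o, 'm) func"
    and \<Phi> :: "nat \<Rightarrow> nat \<Rightarrow> 'o \<Rightarrow> 'm"
    and X :: 'o and f :: "nat \<Rightarrow> 'm"
  assumes "abelian_category A"
    and "n \<ge> 1"
    and "\<And>i. i \<in> {1..n} \<Longrightarrow> additive_functor A A (F i)"
    and "\<And>i. i \<in> {1..n} \<Longrightarrow> right_exact A A (F i)"
    and "\<And>i. i \<in> {1..n} \<Longrightarrow> has_right_adjoint A A (F i)"
    and "nat_trans_family A n F \<Phi>"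
    and "associative_family A n F \<Phi>"
    and "enough_projectives A"
    and "(X, f) \<in> Ob (trivial_extension A n F \<Phi>)"
  shows "(projective (trivial_extension A n F \<Phi>) (X, f) \<longleftrightarrow>
           (\<exists>P. projective A P \<and> direct_summand (trivial_extension A n F \<Phi>) (X, f) (T_ob A n F \<Phi> P)))
       \<and> ((\<exists>P. projective A P \<and> direct_summand (trivial_extension A n F \<Phi>) (X, f) (T_ob A n F \<Phi> P)) \<longleftrightarrow>
           (projective A (C_ob A n F (X, f)) \<and>
            isomorphic (trivial_extension A n F \<Phi>) (T_ob A n F \<Phi> (C_ob A n F (X, f))) (X, f)))"
proof -
  interpret n_trivial_extension A n F \<Phi>
    using assms by (simp add: n_trivial_extension_def n_trivial_extension_axioms_def)
  \<comment> \<open>Assertions (2) and (3) are each compared with (1), and their equivalence follows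
    by passing through it.\<close>
  show ?thesis
    using projective_if_direct_summand direct_summand_if_projective[OF \<open>enough_projectives A\<close>]
      projective_C_ob T_C_isomorphic_if_projective projective_if_isomorphic_T_ob
    by blast
qed

end
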